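(* Let $X=\{0,1,\ldots,7\}$, $Y=\{a,b,c,d\}$, and let $v=yx_1x_2\ldots$ and $w=y'x_1'x_2'\ldots$ be elements of $Y\times X^\infty$. Let $G$ be the subgroup of the symmetric group $\mathrm{Sym}(X)$ generated by the permutations $(1357)(2460)$ and $(04)(13)(57)$ (a group isomorphic to the dihedral group of order $8$). Then the infinite graphs $\Gamma_v$ and $\Gamma_w$, regarded as unrooted graphs, are isomorphic if and only if there exists $\sigma\in G$ such that the infinite word $x_1'x_2'\ldots$ is cofinal with $\sigma(x_1x_2\ldots):=\sigma(x_1)\sigma(x_2)\ldots$.
   Context: Construction. Let $t_0=(0,0)$, $t_1=(1,0)$, $t_2=(2,0)$, $t_3=(2,1)$, $t_4=(2,2)$, $t_5=(1,2)$, $t_6=(0,2)$, $t_7=(0,1)$; these are the lower-left corners of the eight outer unit cells of the $3\times 3$ grid $[0,3]^2$ (the middle cell is omitted). The graph $\Gamma_1$ is the 4-cycle embedded as the unit square with vertices $a=(0,0)$, $b=(1,0)$, $c=(1,1)$, $d=(0,1)$ and its four sides as edges. For $n\ge1$, $\Gamma_{n+1}$ is the union of the eight translated copies $\Gamma_n+3^{n-1}t_k$, $k=0,\ldots,7$ (vertices with equal coordinates identified, edge sets united); adjacent copies share a common side and the middle cell is empty except for its boundary. For a finite word $yx_1\ldots x_{n-1}$ ($y\in Y$, $x_i\in X$) the corresponding vertex of $\Gamma_n$ is the point $p(y)+\sum_{i=1}^{n-1}3^{i-1}t_{x_i}$, where $p(a)=(0,0),p(b)=(1,0),p(c)=(1,1),p(d)=(0,1)$.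 For $w=yx_1x_2\ldots\in Y\times X^\infty$ let $w_n=yx_1\ldots x_{n-1}$ and let $\Gamma^n_w$ be $\Gamma_n$ rooted at the vertex $w_n$ (equivalently, $\Gamma^{n+1}_w$ is built from 8 copies of $\Gamma^n_w$ in positions $0,\ldots,7$ with root the root of the copy in position $x_n$). The infinite rooted graph $\Gamma_w$ is the limit of $\Gamma^n_w$ in the sense that for each $r>0$ the ball of radius $r$ about the root of $\Gamma_w$ is isomorphic to the ball of radius $r$ about $w_n$ in $\Gamma^n_w$ for all large $n$ (concretely, the increasing union of the $\Gamma^n_w$ translated so that their roots are at the origin). Two infinite words over $X$ are cofinal if they differ in only finitely many positions. *)

theory Defs
  imports
    "HOL-Library.Product_Plus"
    "HOL-Combinatorics.Cycles"
    "HOL-Algebra.Generated_Groups"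
begin

section \<open>Undirected graphs\<close>

text \<open>An edge is the set of its two endpoints.\<close>

record 'v ugraph =
  verts :: "'v set"
  edges :: "'v set set"

definition graph_Union :: "'v ugraph set \<Rightarrow> 'v ugraph" where
  "graph_Union \<G> = \<lparr>verts = (\<Union>H\<in>\<G>. verts H), edges = (\<Union>H\<in>\<G>. edges H)\<rparr>"

definition graph_isomorphic :: "'u ugraph \<Rightarrow> 'v ugraph \<Rightarrow> bool" where
  "graph_isomorphic G H \<longleftrightarrow>
     (\<exists>f. bij_betw f (verts G) (verts H) \<and>
          (\<forall>u\<in>verts G. \<forall>v\<in>verts G. {u, v} \<in> edges G \<longleftrightarrow> {f u, f v} \<in> edges H))"

section \<open>Finite Sierpinski carpet graphs\<close>

type_synonym point = "int \<times> int"

definition scale :: "int \<Rightarrow> point \<Rightarrow> point" where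
  "scale c p = (c * fst p, c * snd p)"

definition translate :: "point \<Rightarrow> point ugraph \<Rightarrow> point ugraph" where
  "translate s G =
     \<lparr>verts = (\<lambda>p. p + s) ` verts G, edges = (\<lambda>e. (\<lambda>p. p + s) ` e) ` edges G\<rparr>"

datatype corner = Corner_a | Corner_b | Corner_c | Corner_d

fun corner_pos :: "corner \<Rightarrow> point" where
  "corner_pos Corner_a = (0, 0)"
| "corner_pos Corner_b = (1, 0)"
| "corner_pos Corner_c = (1, 1)"
| "corner_pos Corner_d = (0, 1)"

definition unit_square :: "point ugraph" where
  "unit_square =
     \<lparr>verts = range corner_pos,
      edges = {{corner_pos Corner_a, corner_pos Corner_b},
               {corner_pos Corner_b, corner_pos Corner_c},
               {corner_pos Corner_c, corner_pos Corner_d},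
               {corner_pos Corner_d, corner_pos Corner_a}}\<rparr>"

definition X :: "nat set" where
  "X = {0..7}"

text \<open>Only the values at arguments in \<open>X\<close> are meaningful.\<close>

definition cell :: "nat \<Rightarrow> point" where
  "cell k = [(0,0), (1,0), (2,0), (2,1), (2,2), (1,2), (0,2), (0,1)] ! k"

text \<open>
  Levels are counted from 0 here: \<open>carpet n\<close>, of side length \<open>3 ^ n\<close>, is the graph
  \<open>\<Gamma>\<close> with index \<open>n + 1\<close>.
\<close>

primrec carpet :: "nat \<Rightarrow> point ugraph" where
  "carpet 0 = unit_square"
| "carpet (Suc n) = graph_Union ((\<lambda>k. translate (scale (3 ^ n) (cell k)) (carpet n)) ` X)"

section \<open>Infinite carpet graphs\<close>

text \<open>
  An element \<open>y x\<^sub>1 x\<^sub>2 \<dots>\<close> of \<open>Y \<times> X\<^sup>\<infinity>\<close> is given by a corner \<open>y\<close> and a sequence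
  \<open>x :: nat \<Rightarrow> nat\<close> with values in \<open>X\<close>, where \<open>x i\<close> is the letter with index \<open>i + 1\<close>.
  Then \<open>root_pos y x n\<close> is the vertex of \<open>carpet n\<close> addressed by \<open>y x\<^sub>1 \<dots> x\<^sub>n\<close>.
\<close>

definition root_pos :: "corner \<Rightarrow> (nat \<Rightarrow> nat) \<Rightarrow> nat \<Rightarrow> point" where
  "root_pos y x n = corner_pos y + (\<Sum>i<n. scale (3 ^ i) (cell (x i)))"

text \<open>
  The limit of the rooted graphs \<open>(carpet n, root_pos y x n)\<close>, realized as the union of the
  translates that move the root to the origin; these increase with \<open>n\<close>.
  The root \<open>(0, 0)\<close> is not part of the structure.
\<close>

definition inf_carpet :: "corner \<Rightarrow> (nat \<Rightarrow> nat) \<Rightarrow> point ugraph" where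
  "inf_carpet y x = graph_Union (range (\<lambda>n. translate (- root_pos y x n) (carpet n)))"

section \<open>Words and the symmetry group\<close>

definition cofinal_words :: "(nat \<Rightarrow> nat) \<Rightarrow> (nat \<Rightarrow> nat) \<Rightarrow> bool" where
  "cofinal_words u v \<longleftrightarrow> finite {i. u i \<noteq> v i}"

text \<open>
  The library's \<open>sym_group n\<close> acts on \<open>{1..n}\<close>; the symmetric group on an arbitrary set is
  needed here.
\<close>

definition Sym :: "'a set \<Rightarrow> ('a \<Rightarrow> 'a) monoid" where
  "Sym S = \<lparr>carrier = {p. p permutes S}, mult = (\<circ>), one = id\<rparr>"

definition symmetries :: "(nat \<Rightarrow> nat) set" where
  "symmetries = generate (Sym X)
     {cycle_of_list [1, 3, 5, 7] \<circ> cycle_of_list [2, 4, 6, 0],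
      cycle_of_list [0, 4] \<circ> cycle_of_list [1, 3] \<circ> cycle_of_list [5, 7]}"

end

theory Submission
  imports Defs
begin

text \<open>
  An infinite carpet is a union of unit cells, so a symmetry of the unit square, which permutes the
  letters by the corresponding \<open>\<sigma>\<close>, and a translation, which absorbs finitely many changed
  letters, are isomorphisms.

  Conversely, an isomorphism maps the root square onto a unit square. After composing with a
  symmetry and a translation it fixes the root square, hence also every edge-adjacent cell, because
  an edge lies in only two unit squares of the grid, and so it is the identity. Therefore the
  vertex sets of the two carpets, for the words \<open>\<sigma> \<circ> x\<close> and \<open>x'\<close>, differ by a translation by some \<open>\<tau>\<close>.
  The position of a hole of size \<open>3 ^ m\<close> determines the partial sum of the word's cell positions
  modulo \<open>3 ^ (m + 1)\<close>, so the difference of the partial sums of the two words plus \<open>\<tau>\<close> is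
  divisible by ever larger powers of 3. Its absolute value is too small for that unless it is
  eventually 0, and then the letters agree.
\<close>

section \<open>Graph isomorphism\<close>

lemma ugraph_eqI:
  fixes G H :: "'v ugraph"
  assumes "verts G = verts H" and "edges G = edges H"
  shows "G = H"
  using assms by simp

lemma graph_isomorphic_sym:
  assumes "graph_isomorphic G H"
  shows "graph_isomorphic H G"
proof -
  obtain f where f: "bij_betw f (verts G) (verts H)"
    and e: "\<forall>u\<in>verts G. \<forall>v\<in>verts G. {u, v} \<in> edges G \<longleftrightarrow> {f u, f v} \<in> edges H"
    using assms unfolding graph_isomorphic_def by blast
  let ?g = "inv_into (verts G) f"
  have "bij_betw ?g (verts H) (verts G)"
    using f by (rule bij_betw_inv_into)
  moreover have "{u, v} \<in> edges H \<longleftrightarrow> {?g u, ?g v} \<in> edges G"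
    if "u \<in> verts H" "v \<in> verts H" for u v
  proof -
    have "?g u \<in> verts G" "?g v \<in> verts G" "f (?g u) = u" "f (?g v) = v"
      using that f
      by (simp_all add: bij_betw_inv_into_right bij_betw_imp_surj_on inv_into_into)
    then show ?thesis using e by metis
  qed
  ultimately show ?thesis
    unfolding graph_isomorphic_def by blast
qed

lemma graph_isomorphic_trans:
  assumes "graph_isomorphic G H" and "graph_isomorphic H K"
  shows "graph_isomorphic G K"
proof -
  obtain f where f: "bij_betw f (verts G) (verts H)"
    and ef: "\<forall>u\<in>verts G. \<forall>v\<in>verts G. {u, v} \<in> edges G \<longleftrightarrow> {f u, f v} \<in> edges H"
    using assms(1) unfolding graph_isomorphic_def by blast
  obtain g where g: "bij_betw g (verts H) (verts K)"
    and eg: "\<forall>u\<in>verts H. \<forall>v\<in>verts H. {u, v} \<in> edges H \<longleftrightarrow> {g u, g v} \<in> edges K"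
    using assms(2) unfolding graph_isomorphic_def by blast
  have "bij_betw (g \<circ> f) (verts G) (verts K)"
    using f g by (rule bij_betw_trans)
  moreover have "\<forall>u\<in>verts G. \<forall>v\<in>verts G. {u, v} \<in> edges G \<longleftrightarrow> {(g \<circ> f) u, (g \<circ> f) v} \<in> edges K"
    using ef eg bij_betwE[OF f] by simp
  ultimately show ?thesis
    unfolding graph_isomorphic_def by blast
qed

definition graph_image :: "('u \<Rightarrow> 'v) \<Rightarrow> 'u ugraph \<Rightarrow> 'v ugraph" where
  "graph_image f G = \<lparr>verts = f ` verts G, edges = (`) f ` edges G\<rparr>"

lemma verts_graph_image [simp]: "verts (graph_image f G) = f ` verts G"
  and edges_graph_image [simp]: "edges (graph_image f G) = (`) f ` edges G"
  by (simp_all add: graph_image_def)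

lemma graph_image_comp: "graph_image f (graph_image g G) = graph_image (f \<circ> g) G"
  by (rule ugraph_eqI) (simp_all add: image_comp comp_def)

lemma graph_image_ident: "graph_image (\<lambda>v. v) G = G"
  by (rule ugraph_eqI) simp_all

lemma graph_image_graph_Union:
  "graph_image f (graph_Union \<G>) = graph_Union (graph_image f ` \<G>)"
  by (rule ugraph_eqI) (auto simp: graph_Union_def)

lemma translate_eq_graph_image: "translate s G = graph_image (\<lambda>p. p + s) G"
  by (simp add: translate_def graph_image_def)

lemma graph_isomorphic_graph_image:
  assumes "inj f"
  shows "graph_isomorphic G (graph_image f G)"
proof -
  have "bij_betw f (verts G) (verts (graph_image f G))"
    using assms by (simp add: bij_betw_def inj_on_def)
  moreover have "{u, v} \<in> edges G \<longleftrightarrow> {f u, f v} \<in> edges (graph_image f G)" for u v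
  proof -
    have "{f u, f v} \<in> edges (graph_image f G) \<longleftrightarrow> f ` {u, v} \<in> (`) f ` edges G"
      by simp
    also have "\<dots> \<longleftrightarrow> {u, v} \<in> edges G"
      by (intro inj_image_mem_iff injI) (simp only: inj_image_eq_iff[OF assms])
    finally show ?thesis by simp
  qed
  ultimately show ?thesis
    unfolding graph_isomorphic_def by blast
qed

section \<open>Carpets as unions of unit cells\<close>

lemma scale_add: "scale c (p + q) = scale c p + scale c q"
  by (simp add: scale_def algebra_simps prod_eq_iff)

lemma fst_scale [simp]: "fst (scale c p) = c * fst p"
  and snd_scale [simp]: "snd (scale c p) = c * snd p"
  by (simp_all add: scale_def)

lemma in_X_cases:
  assumes "k \<in> X"
  obtains "k = 0" | "k = 1" | "k = 2" | "k = 3" | "k = 4" | "k = 5" | "k = 6" | "k = 7"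
proof -
  have "k = 0 \<or> k = 1 \<or> k = 2 \<or> k = 3 \<or> k = 4 \<or> k = 5 \<or> k = 6 \<or> k = 7"
    using assms unfolding X_def by (simp, linarith)
  then show ?thesis using that by blast
qed

lemma X_eq: "X = {0, 1, 2, 3, 4, 5, 6, 7}"
  by (auto elim: in_X_cases simp: X_def)

lemma cell_simps [simp]:
  "cell 0 = (0, 0)" "cell 1 = (1, 0)" "cell (Suc 0) = (1, 0)" "cell 2 = (2, 0)" "cell 3 = (2, 1)"
  "cell 4 = (2, 2)" "cell 5 = (1, 2)" "cell 6 = (0, 2)" "cell 7 = (0, 1)"
  by (simp_all add: cell_def)

lemma cell_inj:
  assumes "j \<in> X" "k \<in> X" "cell j = cell k"
  shows "j = k"
  using assms by (elim in_X_cases) simp_all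

lemma cell_bounds:
  assumes "k \<in> X"
  shows "fst (cell k) \<in> {0..2}" "snd (cell k) \<in> {0..2}"
  using assms by (elim in_X_cases; simp)+

lemma cell_surj:
  assumes "s \<in> {0, 1, 2}" "t \<in> {0, 1, 2}" "(s, t) \<noteq> (1, 1)"
  obtains k where "k \<in> X" "cell k = (s, t)"
proof -
  have "(s, t) \<in> cell ` X"
    using assms by (auto simp: X_eq)
  then show ?thesis using that by auto
qed

lemma cell_not_middle: "k \<in> X \<Longrightarrow> cell k \<noteq> (1, 1)"
  by (elim in_X_cases) simp_all

text \<open>Lower-left corners of the unit cells that make up \<open>carpet n\<close>. On this plain
  set of points translations and linear maps act directly, and the graph is recovered by
  \<open>cell_graph\<close>.\<close>

primrec cells :: "nat \<Rightarrow> point set" where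
  "cells 0 = {0}"
| "cells (Suc n) = (\<Union>k\<in>X. (\<lambda>c. c + scale (3 ^ n) (cell k)) ` cells n)"

definition cell_graph :: "point set \<Rightarrow> point ugraph" where
  "cell_graph C = graph_Union ((\<lambda>c. translate c unit_square) ` C)"

lemma cell_graph_UN: "cell_graph (\<Union>i\<in>I. C i) = graph_Union ((\<lambda>i. cell_graph (C i)) ` I)"
  by (rule ugraph_eqI) (auto simp: cell_graph_def graph_Union_def)

lemma translate_cell_graph: "translate s (cell_graph C) = cell_graph ((\<lambda>c. c + s) ` C)"
  unfolding cell_graph_def translate_eq_graph_image graph_image_graph_Union
  by (simp add: image_comp comp_def graph_image_comp add.assoc)

lemma carpet_eq_cell_graph: "carpet n = cell_graph (cells n)"
proof (induction n)
  case 0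
  then show ?case
    by (intro ugraph_eqI)
      (simp_all add: cell_graph_def graph_Union_def translate_eq_graph_image)
next
  case (Suc n)
  then show ?case
    by (simp add: cell_graph_UN translate_cell_graph)
qed

text \<open>The lower-left corner of the cell that carries the root: \<open>root_pos\<close> without
  the contribution of \<open>y\<close>. Subtracting it puts the root cell at the origin.\<close>

definition offset :: "(nat \<Rightarrow> nat) \<Rightarrow> nat \<Rightarrow> point" where
  "offset x n = (\<Sum>i<n. scale (3 ^ i) (cell (x i)))"

lemma offset_0 [simp]: "offset x 0 = 0"
  and offset_Suc: "offset x (Suc n) = offset x n + scale (3 ^ n) (cell (x n))"
  by (simp_all add: offset_def)

definition inf_cells :: "(nat \<Rightarrow> nat) \<Rightarrow> point set" where
  "inf_cells x = (\<Union>n. (\<lambda>c. c - offset x n) ` cells n)"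

text \<open>The letter \<open>y\<close> enters only through a translation, so it cannot influence
  the isomorphism type, and the cell set of \<open>x\<close> carries everything that
  matters.\<close>

lemma inf_carpet_eq: "inf_carpet y x = translate (- corner_pos y) (cell_graph (inf_cells x))"
proof -
  have "translate (- root_pos y x n) (carpet n) =
        translate (- corner_pos y) (cell_graph ((\<lambda>c. c - offset x n) ` cells n))" for n
    unfolding carpet_eq_cell_graph translate_cell_graph root_pos_def offset_def[symmetric]
    by (simp add: image_comp comp_def algebra_simps)
  then show ?thesis
    unfolding inf_carpet_def inf_cells_def cell_graph_UN
    by (simp add: translate_eq_graph_image graph_image_graph_Union image_comp comp_def)
qed

lemma graph_isomorphic_translate: "graph_isomorphic G (translate s G)"
  unfolding translate_eq_graph_image by (rule graph_isomorphic_graph_image) (simp add: inj_def)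

lemma inf_carpet_isomorphic_iff:
  "graph_isomorphic (inf_carpet y x) (inf_carpet y' x') \<longleftrightarrow>
   graph_isomorphic (cell_graph (inf_cells x)) (cell_graph (inf_cells x'))"
  unfolding inf_carpet_eq
  by (meson graph_isomorphic_translate graph_isomorphic_sym graph_isomorphic_trans)

lemma shifted_cells_mono:
  assumes "\<And>i. x i \<in> X" and "m \<le> n"
  shows "(\<lambda>c. c - offset x m) ` cells m \<subseteq> (\<lambda>c. c - offset x n) ` cells n"
  using assms(2)
proof (induction n rule: dec_induct)
  case base
  then show ?case by simp
next
  case (step n)
  have "(\<lambda>c. c - offset x n) ` cells n \<subseteq> (\<lambda>c. c - offset x (Suc n)) ` cells (Suc n)"
  proof
    fix p assume "p \<in> (\<lambda>c. c - offset x n) ` cells n"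
    then obtain c where c: "c \<in> cells n" "p = c - offset x n" by blast
    have "c + scale (3 ^ n) (cell (x n)) \<in> cells (Suc n)"
      using c assms(1) by auto
    moreover have "p = (c + scale (3 ^ n) (cell (x n))) - offset x (Suc n)"
      using c by (simp add: offset_Suc algebra_simps)
    ultimately show "p \<in> (\<lambda>c. c - offset x (Suc n)) ` cells (Suc n)" by blast
  qed
  with step show ?case by blast
qed

text \<open>The stages increase, so any initial segment of them may be dropped. This allows two
  words to be compared only where they already agree.\<close>

lemma inf_cells_tail:
  assumes "\<And>i. x i \<in> X"
  shows "inf_cells x = (\<Union>n\<in>{m..}. (\<lambda>c. c - offset x n) ` cells n)"
proof -
  have "(\<lambda>c. c - offset x n) ` cells n \<subseteq> (\<lambda>c. c - offset x (max m n)) ` cells (max m n)" for n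
    by (rule shifted_cells_mono) (use assms in auto)
  moreover have "max m n \<in> {m..}" for n by simp
  ultimately show ?thesis
    unfolding inf_cells_def by blast
qed

lemma cofinal_imp_isomorphic:
  assumes "\<And>i. x i \<in> X" "\<And>i. x' i \<in> X" and "cofinal_words x x'"
  shows "graph_isomorphic (cell_graph (inf_cells x)) (cell_graph (inf_cells x'))"
proof -
  obtain m where m: "\<And>i. i \<ge> m \<Longrightarrow> x i = x' i"
    using assms(3) unfolding cofinal_words_def finite_nat_set_iff_bounded
    by (metis (mono_tags, lifting) leD mem_Collect_eq)
  \<comment> \<open>Beyond position \<open>m\<close> both offsets grow by the same summands, so
    their difference stays \<open>d\<close>, and the cell sets are translates by
    \<open>d\<close>.\<close>
  define d where "d = offset x m - offset x' m"
  have "offset x n = offset x' n + d" if "n \<ge> m" for n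
    using that by (induction n rule: dec_induct) (simp_all add: d_def offset_Suc m algebra_simps)
  then have "inf_cells x' = (\<lambda>c. c + d) ` inf_cells x"
    unfolding inf_cells_tail[of x m, OF assms(1)] inf_cells_tail[of x' m, OF assms(2)] image_UN
    by (simp add: image_comp comp_def algebra_simps)
  then show ?thesis
    by (metis translate_cell_graph graph_isomorphic_translate)
qed

section \<open>Symmetries of the unit square\<close>

text \<open>\<open>A\<close> is the linear part of a symmetry and \<open>v\<close> moves the image
  of the \<open>3 \<times> 3\<close> block back onto the block. The vectors \<open>v\<close> of all
  levels add up to the displayed sum.\<close>

lemma cells_image:
  assumes add: "\<And>p q. A (p + q) = A p + A q"
    and scale: "\<And>c p. A (scale c p) = scale c (A p)"
    and cell: "\<And>k. k \<in> X \<Longrightarrow> cell (\<sigma> k) = A (cell k) + v"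
    and "\<sigma> ` X = X"
  shows "cells n = (\<lambda>c. A c + (\<Sum>i<n. scale (3 ^ i) v)) ` cells n"
proof (induction n)
  case 0
  have "A 0 = 0" using add[of 0 0] by simp
  then show ?case by simp
next
  case (Suc n)
  let ?w = "\<lambda>n. \<Sum>i<n. scale (3 ^ i) v"
  have "(\<lambda>c. A c + ?w (Suc n)) ` cells (Suc n)
      = (\<Union>k\<in>X. (\<lambda>c. (A c + ?w n) + scale (3 ^ n) (cell (\<sigma> k))) ` cells n)"
    by (simp add: image_UN image_comp comp_def add scale cell scale_add add.assoc add.left_commute
        add.commute)
  also have "\<dots> = (\<Union>k\<in>X. (\<lambda>c. c + scale (3 ^ n) (cell (\<sigma> k))) ` cells n)"
    by (subst (2) Suc.IH) (simp add: image_comp comp_def)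
  also have "\<dots> = (\<Union>k\<in>\<sigma> ` X. (\<lambda>c. c + scale (3 ^ n) (cell k)) ` cells n)"
    by simp
  finally show ?case
    using assms(4) by simp
qed

text \<open>The accumulated translation occurs both in the cells and in the offset and cancels, so
  that only the linear part \<open>A\<close> remains.\<close>

lemma inf_cells_image:
  assumes add: "\<And>p q. A (p + q) = A p + A q"
    and scale: "\<And>c p. A (scale c p) = scale c (A p)"
    and cell: "\<And>k. k \<in> X \<Longrightarrow> cell (\<sigma> k) = A (cell k) + v"
    and \<sigma>: "\<sigma> ` X = X"
    and x: "\<And>i. x i \<in> X"
  shows "inf_cells (\<sigma> \<circ> x) = A ` inf_cells x"
proof -
  let ?w = "\<lambda>n. \<Sum>i<n. scale (3 ^ i) v"
  have A0: "A 0 = 0" using add[of 0 0] by simp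
  then have "A (c - d) = A c - A d" for c d
    using add[of "c - d" d] by simp
  moreover have "offset (\<sigma> \<circ> x) n = A (offset x n) + ?w n" for n
    by (induction n) (simp_all add: A0 offset_Suc add scale cell x scale_add)
  ultimately have "(\<lambda>c. c - offset (\<sigma> \<circ> x) n) ` cells n = A ` (\<lambda>c. c - offset x n) ` cells n" for n
    by (subst cells_image[OF add scale cell \<sigma>]) (simp_all add: image_comp comp_def)
  then show ?thesis
    unfolding inf_cells_def by (simp add: image_UN)
qed

text \<open>Here \<open>g\<close> is affine with linear part \<open>A\<close>. Since
  \<open>g\<close> preserves the unit square, the square at \<open>c\<close> goes to the square at
  \<open>A c\<close>: vertices move by \<open>g\<close>, but the names of the cells move by
  \<open>A\<close>.\<close>

lemma graph_image_cell_graph: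
  assumes "\<And>p c. g (p + c) = g p + A c" and "graph_image g unit_square = unit_square"
  shows "graph_image g (cell_graph C) = cell_graph (A ` C)"
proof -
  have "graph_image g (translate c unit_square) = translate (A c) unit_square" for c
    unfolding translate_eq_graph_image
    by (subst (2) assms(2)[symmetric]) (simp only: graph_image_comp comp_def assms(1))
  then show ?thesis
    unfolding cell_graph_def graph_image_graph_Union by (simp add: image_comp comp_def)
qed

text \<open>The counterclockwise quarter turn about the centre of the unit square.\<close>

definition rot :: "point \<Rightarrow> point" where
  "rot p = (1 - snd p, fst p)"

text \<open>The reflection in the diagonal of the unit square through \<open>(1, 0)\<close> and
  \<open>(0, 1)\<close>.\<close>

definition mirror :: "point \<Rightarrow> point" where
  "mirror p = (1 - snd p, 1 - fst p)"

definition rot_perm :: "nat \<Rightarrow> nat" where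
  "rot_perm = cycle_of_list [1, 3, 5, 7] \<circ> cycle_of_list [2, 4, 6, 0]"

definition mirror_perm :: "nat \<Rightarrow> nat" where
  "mirror_perm = cycle_of_list [0, 4] \<circ> cycle_of_list [1, 3] \<circ> cycle_of_list [5, 7]"

lemma symmetries_eq: "symmetries = generate (Sym X) {rot_perm, mirror_perm}"
  by (simp add: symmetries_def rot_perm_def mirror_perm_def)

lemma rot_perm_permutes: "rot_perm permutes X"
  unfolding rot_perm_def
  by (intro permutes_compose permutes_subset[OF cycle_permutes]) (auto simp: X_def)

lemma mirror_perm_permutes: "mirror_perm permutes X"
  unfolding mirror_perm_def
  by (intro permutes_compose permutes_subset[OF cycle_permutes]) (auto simp: X_def)

text \<open>The letters run counterclockwise around the block, so a quarter turn adds 2 modulo 8;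
  the vector \<open>(2, 0)\<close> returns the turned block to its place.\<close>

lemma cell_rot_perm:
  "k \<in> X \<Longrightarrow> cell (rot_perm k) = (- snd (cell k), fst (cell k)) + (2, 0)"
  by (elim in_X_cases) (simp_all add: rot_perm_def transpose_def)

lemma cell_mirror_perm:
  "k \<in> X \<Longrightarrow> cell (mirror_perm k) = (- snd (cell k), - fst (cell k)) + (2, 2)"
  by (elim in_X_cases) (simp_all add: mirror_perm_def transpose_def)

lemma range_corner_pos: "range corner_pos = {(0, 0), (1, 0), (1, 1), (0, 1)}"
proof -
  have U: "(UNIV :: corner set) = {Corner_a, Corner_b, Corner_c, Corner_d}"
    using corner.exhaust by blast
  show ?thesis unfolding U by simp
qed

lemma verts_unit_square: "verts unit_square = {(0, 0), (1, 0), (1, 1), (0, 1)}"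
  and edges_unit_square: "edges unit_square =
    {{(0, 0), (1, 0)}, {(1, 0), (1, 1)}, {(1, 1), (0, 1)}, {(0, 1), (0, 0)}}"
  by (simp_all add: unit_square_def range_corner_pos)

lemma rot_unit_square: "graph_image rot unit_square = unit_square"
  by (rule ugraph_eqI) (auto simp: verts_unit_square edges_unit_square rot_def)

lemma mirror_unit_square: "graph_image mirror unit_square = unit_square"
  by (rule ugraph_eqI)
    (simp_all add: verts_unit_square edges_unit_square mirror_def insert_commute)

lemma rot_cell_graph:
  assumes "\<And>i. x i \<in> X"
  shows "graph_image rot (cell_graph (inf_cells x)) = cell_graph (inf_cells (rot_perm \<circ> x))"
proof -
  let ?A = "\<lambda>p :: point. (- snd p, fst p)"
  have "inf_cells (rot_perm \<circ> x) = ?A ` inf_cells x"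
    by (rule inf_cells_image[where v = "(2, 0)"])
      (simp_all add: assms cell_rot_perm permutes_image[OF rot_perm_permutes] scale_def)
  then show ?thesis
    by (simp add: graph_image_cell_graph[where A = ?A] rot_unit_square rot_def)
qed

lemma mirror_cell_graph:
  assumes "\<And>i. x i \<in> X"
  shows "graph_image mirror (cell_graph (inf_cells x)) = cell_graph (inf_cells (mirror_perm \<circ> x))"
proof -
  let ?A = "\<lambda>p :: point. (- snd p, - fst p)"
  have "inf_cells (mirror_perm \<circ> x) = ?A ` inf_cells x"
    by (rule inf_cells_image[where v = "(2, 2)"])
      (simp_all add: assms cell_mirror_perm permutes_image[OF mirror_perm_permutes] scale_def)
  then show ?thesis
    by (simp add: graph_image_cell_graph[where A = ?A] mirror_unit_square mirror_def)
qed

lemma inj_rot: "inj rot" and inj_mirror: "inj mirror"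
  by (auto simp: inj_def rot_def mirror_def prod_eq_iff)

section \<open>From the two generators to the whole symmetry group\<close>

lemma group_Sym: "group (Sym S)"
proof (rule groupI)
  fix p assume "p \<in> carrier (Sym S)"
  then show "\<exists>q\<in>carrier (Sym S). q \<otimes>\<^bsub>Sym S\<^esub> p = \<one>\<^bsub>Sym S\<^esub>"
    by (auto simp: Sym_def intro!: bexI[of _ "inv_into UNIV p"] permutes_inv_o(2) permutes_inv)
qed (auto simp: Sym_def comp_assoc intro: permutes_compose)

text \<open>The permutation claim is carried through the induction because it keeps
  \<open>\<sigma> \<circ> x\<close> a word over \<open>X\<close>, to which the isomorphism claim of
  the next factor can be applied.\<close>

lemma symmetry_isomorphic:
  assumes "\<sigma> \<in> symmetries"
  shows "\<sigma> permutes X \<and> (\<forall>x. (\<forall>i. x i \<in> X) \<longrightarrow>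
    graph_isomorphic (cell_graph (inf_cells x)) (cell_graph (inf_cells (\<sigma> \<circ> x))))"
proof -
  let ?iso = "\<lambda>x x'. graph_isomorphic (cell_graph (inf_cells x)) (cell_graph (inf_cells x'))"
  interpret Sym: group "Sym X" by (rule group_Sym)
  have gen: "h permutes X \<and> (\<forall>x. (\<forall>i. x i \<in> X) \<longrightarrow> ?iso x (h \<circ> x))"
    if "h \<in> {rot_perm, mirror_perm}" for h
    using that rot_perm_permutes mirror_perm_permutes
      graph_isomorphic_graph_image[OF inj_rot] graph_isomorphic_graph_image[OF inj_mirror]
    by (auto simp: rot_cell_graph[symmetric] mirror_cell_graph[symmetric])
  show ?thesis
    using assms unfolding symmetries_eq
  proof (induction rule: generate.induct)
    case one
    have "?iso x x" for x
      unfolding graph_isomorphic_def by (rule exI[of _ id]) simp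
    then show ?case
      using permutes_id[of X] by (simp only: Sym_def monoid.simps id_comp simp_thms)
  next
    case (incl h)
    then show ?case by (rule gen)
  next
    case (inv h)
    let ?q = "inv\<^bsub>Sym X\<^esub> h"
    have "h \<in> carrier (Sym X)"
      using gen[OF inv] by (simp add: Sym_def)
    then have q: "?q permutes X" and hq: "h \<circ> ?q = id"
      using Sym.inv_closed[of h] Sym.r_inv[of h] by (simp_all add: Sym_def)
    \<comment> \<open>The claim for the generator \<open>h\<close> is applied to the word
      \<open>?q \<circ> x\<close>, which \<open>h\<close> takes back to \<open>x\<close>; the
      isomorphism is then reversed.\<close>
    have "?iso x (?q \<circ> x)" if "\<forall>i. x i \<in> X" for x
    proof -
      have "\<forall>i. (?q \<circ> x) i \<in> X"
        using that q by (simp add: permutes_in_image)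
      then have "?iso (?q \<circ> x) (h \<circ> (?q \<circ> x))"
        using gen[OF inv] by blast
      then show ?thesis
        by (simp add: comp_assoc[symmetric] hq graph_isomorphic_sym)
    qed
    with q show ?case by blast
  next
    case (eng h1 h2)
    have "?iso x (h1 \<circ> h2 \<circ> x)" if x: "\<forall>i. x i \<in> X" for x
    proof -
      have "\<forall>i. (h2 \<circ> x) i \<in> X"
        using x eng.IH(2) by (simp add: permutes_in_image)
      then have "?iso (h2 \<circ> x) (h1 \<circ> (h2 \<circ> x))" "?iso x (h2 \<circ> x)"
        using eng.IH x by blast+
      then show ?thesis
        unfolding comp_assoc by (blast intro: graph_isomorphic_trans)
    qed
    moreover have "h1 \<circ> h2 permutes X"
      using eng.IH by (blast intro: permutes_compose)
    moreover have "h1 \<otimes>\<^bsub>Sym X\<^esub> h2 = h1 \<circ> h2"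
      by (simp add: Sym_def)
    ultimately show ?case by (simp only:) blast
  qed
qed

text \<open>Translates a geometric symmetry, as it will arise from the position of the image of the
  root square, into a letter permutation.\<close>

lemma rot_mirror_cell_graph:
  assumes "\<And>i. x i \<in> X"
  shows "\<exists>\<sigma>\<in>symmetries. graph_image (rot ^^ i \<circ> mirror ^^ j) (cell_graph (inf_cells x)) =
    cell_graph (inf_cells (\<sigma> \<circ> x))"
proof -
  have mem: "h1 \<circ> h2 \<in> symmetries" if "h1 \<in> {rot_perm, mirror_perm}" "h2 \<in> symmetries" for h1 h2
    using generate.eng[OF generate.incl[of h1 "{rot_perm, mirror_perm}" "Sym X"], of h2] that
    by (simp add: symmetries_eq Sym_def)
  have range: "(\<sigma> \<circ> x) i \<in> X" if "\<sigma> \<in> symmetries" for \<sigma> i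
    using symmetry_isomorphic[OF that] assms by (simp add: permutes_in_image)
  have mirror_step: "\<exists>\<sigma>\<in>symmetries. graph_image (mirror ^^ j) (cell_graph (inf_cells x)) =
    cell_graph (inf_cells (\<sigma> \<circ> x))"
  proof (induction j)
    case 0
    have "id \<in> symmetries"
      using generate.one[of "Sym X"] by (simp add: symmetries_eq Sym_def)
    then show ?case
      by (intro bexI[of _ id]) (simp_all add: id_def graph_image_ident)
  next
    case (Suc j)
    then obtain \<sigma> where \<sigma>: "\<sigma> \<in> symmetries"
      "graph_image (mirror ^^ j) (cell_graph (inf_cells x)) = cell_graph (inf_cells (\<sigma> \<circ> x))" by blast
    have "graph_image (mirror ^^ Suc j) (cell_graph (inf_cells x)) =
        cell_graph (inf_cells (mirror_perm \<circ> (\<sigma> \<circ> x)))"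
      by (simp only: funpow.simps graph_image_comp[symmetric] \<sigma>(2)
          mirror_cell_graph[of "\<sigma> \<circ> x", OF range[OF \<sigma>(1)]])
    with mem[of mirror_perm \<sigma>] \<sigma>(1) show ?case
      by (metis comp_assoc insertCI)
  qed
  show ?thesis
  proof (induction i)
    case 0
    then show ?case using mirror_step by (simp only: funpow.simps id_comp)
  next
    case (Suc i)
    then obtain \<sigma> where \<sigma>: "\<sigma> \<in> symmetries"
      "graph_image (rot ^^ i \<circ> mirror ^^ j) (cell_graph (inf_cells x)) = cell_graph (inf_cells (\<sigma> \<circ> x))"
      by blast
    have "graph_image (rot ^^ Suc i \<circ> mirror ^^ j) (cell_graph (inf_cells x)) =
        cell_graph (inf_cells (rot_perm \<circ> (\<sigma> \<circ> x)))"
      by (simp only: funpow.simps comp_assoc graph_image_comp[symmetric])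
        (simp only: graph_image_comp \<sigma>(2)
          rot_cell_graph[of "\<sigma> \<circ> x", OF range[OF \<sigma>(1)]])
    with mem[of rot_perm \<sigma>] \<sigma>(1) show ?case
      by (metis comp_assoc insertCI)
  qed
qed

section \<open>Rigidity\<close>

definition adj :: "point \<Rightarrow> point \<Rightarrow> bool" where
  "adj p q \<longleftrightarrow> q - p \<in> {(1, 0), (- 1, 0), (0, 1), (0, - 1)}"

lemma adj_cases:
  assumes "adj p q"
  obtains "q = p + (1, 0)" | "q = p + (- 1, 0)" | "q = p + (0, 1)" | "q = p + (0, - 1)"
proof -
  have "q = p + (q - p)" by simp
  then show thesis
    using assms that unfolding adj_def by (metis empty_iff insert_iff)
qed

lemma adj_sym: "adj p q \<Longrightarrow> adj q p"
  by (auto simp: adj_def prod_eq_iff)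

lemma adj_translate: "adj (p + r) (q + r) \<longleftrightarrow> adj p q"
  by (simp add: adj_def)

text \<open>The two inequalities say that opposite vertices of the cycle \<open>u\<close>,
  \<open>v\<close>, \<open>b\<close>, \<open>a\<close> differ, which leaves only a unit square. The
  second conjunct expresses that the sides at \<open>u\<close> are perpendicular.\<close>

lemma four_cycle:
  assumes "adj u v" "adj u a" "adj v b" "adj a b" "a \<noteq> v" "b \<noteq> u"
  shows "b = v + (a - u) \<and> (fst u = fst v) = (snd u = snd a)"
  by (insert assms(4-6), rule adj_cases[OF assms(1)]; rule adj_cases[OF assms(2)]; rule adj_cases[OF assms(3)];
      simp add: adj_def prod_eq_iff)+

text \<open>The edge from \<open>u\<close> to \<open>v\<close> lies in two unit squares of the grid,
  and the image of the one on the side of \<open>d\<close> must be one of them. The other has the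
  corner \<open>w = u - d\<close>, which is already the image of itself, so injectivity excludes
  it.\<close>

lemma opposite_side_fixed:
  assumes "inj_on h V" "{u, v, w, u + d, v + d} \<subseteq> V"
    and "h u = u" "h v = v" "h w = w" and w: "w + d = u"
    and "adj u v" and d: "adj 0 d" "d \<noteq> v - u" "d \<noteq> u - v"
    and "adj (h u) (h (u + d))" "adj (h v) (h (v + d))" "adj (h (u + d)) (h (v + d))"
  shows "h (u + d) = u + d \<and> h (v + d) = v + d"
proof -
  have "u + d \<noteq> v" "v + d \<noteq> u" "u + d \<noteq> w"
    using d w by (auto simp: adj_def prod_eq_iff)
  then have "h (u + d) \<noteq> h v" "h (v + d) \<noteq> h u" "h (u + d) \<noteq> h w"
    using assms(1,2) by (auto dest: inj_onD)
  then have ne: "h (u + d) \<noteq> v" "h (v + d) \<noteq> u" "h (u + d) \<noteq> w"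
    using assms(3-5) by simp_all
  have adj: "adj u (h (u + d))" "adj v (h (v + d))"
    using assms(3,4,11,12) by simp_all
  note cyc = four_cycle[OF \<open>adj u v\<close> adj assms(13) ne(1,2)]
  have "h (u + d) = u + d"
    by (insert cyc[THEN conjunct2] ne(1,3) d(2,3) w, rule adj_cases[OF \<open>adj u v\<close>];
        rule adj_cases[OF d(1)]; rule adj_cases[OF adj(1)]; force simp: prod_eq_iff)
  with cyc show ?thesis by (simp add: algebra_simps)
qed

definition corners :: "point \<Rightarrow> point set" where
  "corners c = {c, c + (1, 0), c + (1, 1), c + (0, 1)}"

lemma corners_eq: "corners c = verts (translate c unit_square)"
  by (simp add: corners_def translate_eq_graph_image verts_unit_square add.commute
      flip: zero_prod_def)

lemma verts_cell_graph: "verts (cell_graph C) = (\<Union>c\<in>C. corners c)"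
  by (simp add: cell_graph_def graph_Union_def corners_eq)

lemma square_edges_in_cell_graph:
  assumes "c \<in> C"
  shows "{c, c + (1, 0)} \<in> edges (cell_graph C)" "{c + (1, 0), c + (1, 1)} \<in> edges (cell_graph C)"
    "{c + (0, 1), c + (1, 1)} \<in> edges (cell_graph C)" "{c, c + (0, 1)} \<in> edges (cell_graph C)"
proof -
  have "edges (translate c unit_square) =
      {{c, c + (1, 0)}, {c + (1, 0), c + (1, 1)}, {c + (1, 1), c + (0, 1)}, {c + (0, 1), c}}"
    by (simp add: translate_eq_graph_image edges_unit_square add.commute
        flip: zero_prod_def)
  then show "{c, c + (1, 0)} \<in> edges (cell_graph C)" "{c + (1, 0), c + (1, 1)} \<in> edges (cell_graph C)"
    "{c + (0, 1), c + (1, 1)} \<in> edges (cell_graph C)" "{c, c + (0, 1)} \<in> edges (cell_graph C)"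
    using assms by (auto simp: cell_graph_def graph_Union_def insert_commute intro!: bexI[of _ c])
qed

text \<open>Grid adjacency is all that the rigidity argument needs to know about the images of
  edges.\<close>

lemma edge_in_cell_graph_adj:
  assumes "{p, q} \<in> edges (cell_graph C)"
  shows "adj p q"
proof -
  obtain c where "{p, q} \<in> edges (translate c unit_square)"
    using assms by (auto simp: cell_graph_def graph_Union_def)
  then show ?thesis
    by (auto simp: translate_eq_graph_image edges_unit_square adj_def doubleton_eq_iff prod_eq_iff)
qed

lemma neighbour_cell_fixed:
  assumes inj: "inj_on h (verts (cell_graph C))"
    and adj: "\<And>p q. {p, q} \<in> edges (cell_graph C) \<Longrightarrow> adj (h p) (h q)"
    and c: "c \<in> C" "c' \<in> C" "adj c c'"
    and fixed: "\<And>p. p \<in> corners c \<Longrightarrow> h p = p"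
    and p: "p \<in> corners c'"
  shows "h p = p"
proof -
  have sub: "corners c \<subseteq> verts (cell_graph C)" "corners c' \<subseteq> verts (cell_graph C)"
    using c by (auto simp: verts_cell_graph)
  note E = square_edges_in_cell_graph[OF c(2), THEN adj]
  note opp = opposite_side_fixed[OF inj]
  have fixed': "h c = c" "h (c + (1, 0)) = c + (1, 0)" "h (c + (1, 1)) = c + (1, 1)"
    "h (c + (0, 1)) = c + (0, 1)"
    using fixed by (simp_all add: corners_def)
  note simps = corners_def prod_eq_iff adj_def
  \<comment> \<open>In each direction \<open>u\<close> and \<open>v\<close> are the ends of the
    common side, \<open>d\<close> is \<open>c' - c\<close>, and \<open>w\<close> is the vertex of
    the fixed square that lies behind \<open>u\<close>.\<close>
  show ?thesis
    using c(3)
  proof (cases rule: adj_cases)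
    case 1
    have "h (c + (1, 0) + (1, 0)) = c + (1, 0) + (1, 0) \<and> h (c + (1, 1) + (1, 0)) = c + (1, 1) + (1, 0)"
      by (rule opp[where w = "c"]) (use sub fixed E E[THEN adj_sym] in \<open>simp_all add: 1 simps add.assoc\<close>)
    then show ?thesis using p fixed' by (auto simp: 1 corners_def add.assoc
        simp flip: zero_prod_def)
  next
    case 2
    have "h (c + (- 1, 0)) = c + (- 1, 0) \<and> h (c + (0, 1) + (- 1, 0)) = c + (0, 1) + (- 1, 0)"
      by (rule opp[where w = "c + (1, 0)"]) (use sub fixed E E[THEN adj_sym] in \<open>simp_all add: 2 simps add.assoc\<close>)
    then show ?thesis using p fixed' by (auto simp: 2 corners_def add.assoc
        simp flip: zero_prod_def)
  next
    case 3
    have "h (c + (0, 1) + (0, 1)) = c + (0, 1) + (0, 1) \<and> h (c + (1, 1) + (0, 1)) = c + (1, 1) + (0, 1)"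
      by (rule opp[where w = "c"]) (use sub fixed E E[THEN adj_sym] in \<open>simp_all add: 3 simps add.assoc\<close>)
    then show ?thesis using p fixed' by (auto simp: 3 corners_def add.assoc
        simp flip: zero_prod_def)
  next
    case 4
    have "h (c + (0, - 1)) = c + (0, - 1) \<and> h (c + (1, 0) + (0, - 1)) = c + (1, 0) + (0, - 1)"
      by (rule opp[where w = "c + (0, 1)"]) (use sub fixed E E[THEN adj_sym] in \<open>simp_all add: 4 simps add.assoc\<close>)
    then show ?thesis using p fixed' by (auto simp: 4 corners_def add.assoc
        simp flip: zero_prod_def)
  qed
qed

section \<open>Connectedness of the cells through shared sides\<close>

lemma corner_cells:
  "(0, 0) \<in> cells n" "(3 ^ n - 1, 0) \<in> cells n" "(0, 3 ^ n - 1) \<in> cells n"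
proof (induction n)
  case (Suc n)
  {
    case 1
    show ?case using Suc(1) by (auto simp: X_eq scale_def simp flip: zero_prod_def)
  next
    case 2
    have "(3 ^ n - 1, 0) + scale (3 ^ n) (cell 2) \<in> cells (Suc n)"
      using Suc(2) by (auto simp: X_eq simp del: cell_simps)
    then show ?case by (simp add: scale_def)
  next
    case 3
    have "(0, 3 ^ n - 1) + scale (3 ^ n) (cell 6) \<in> cells (Suc n)"
      using Suc(3) by (auto simp: X_eq simp del: cell_simps)
    then show ?case by (simp add: scale_def)
  }
qed (simp_all add: zero_prod_def)

text \<open>Horizontally, the lower right cell of one copy touches the lower left cell of the next;
  vertically, the upper left cell touches the lower left cell of the copy above.\<close>

lemma adjacent_copies:
  assumes "adj (cell j) (cell k)"
  obtains c c' where "c \<in> cells n" "c' \<in> cells n"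
    "adj (c + scale (3 ^ n) (cell j)) (c' + scale (3 ^ n) (cell k))"
proof -
  note that' = that[OF corner_cells(2,1)] that[OF corner_cells(1,2)]
    that[OF corner_cells(3,1)] that[OF corner_cells(1,3)]
  show thesis
    using assms by (rule adj_cases) (use that' in \<open>auto simp: adj_def scale_def algebra_simps\<close>)
qed

text \<open>The eight outer cells of a \<open>3 \<times> 3\<close> block form a cycle of edge-adjacent cells.\<close>

lemma cells_connected:
  assumes "\<And>c c'. c \<in> cells n \<Longrightarrow> c' \<in> cells n \<Longrightarrow> I c \<Longrightarrow> adj c c' \<Longrightarrow> I c'"
    and "c0 \<in> cells n" "I c0" "c \<in> cells n"
  shows "I c"
  using assms
proof (induction n arbitrary: I c0 c)
  case 0
  then show ?case by simp
next
  case (Suc n)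
  let ?s = "\<lambda>k. scale (3 ^ n) (cell k)"
  define J where "J k \<longleftrightarrow> (\<forall>c\<in>cells n. I (c + ?s k))" for k
  have mem: "c + ?s k \<in> cells (Suc n)" if "c \<in> cells n" "k \<in> X" for c k
    using that by auto
  \<comment> \<open>The induction hypothesis inside a single copy: one cell with \<open>I\<close>
    infects the whole copy.\<close>
  have meets: "J k" if "k \<in> X" "c \<in> cells n" "I (c + ?s k)" for k c
    unfolding J_def
  proof
    fix c' assume c': "c' \<in> cells n"
    show "I (c' + ?s k)"
    proof (rule Suc.IH[where I = "\<lambda>c. I (c + ?s k)"])
      fix a b assume "a \<in> cells n" "b \<in> cells n" "I (a + ?s k)" "adj a b"
      then show "I (b + ?s k)"
        using Suc.prems(1)[of "a + ?s k" "b + ?s k"] mem that(1) by (simp add: adj_translate)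
    qed (use that c' in auto)
  qed
  have step: "J k" if jk: "J j" "j \<in> X" "k \<in> X" "adj (cell j) (cell k)" for j k
  proof -
    obtain a b where "a \<in> cells n" "b \<in> cells n" "adj (a + ?s j) (b + ?s k)"
      using adjacent_copies[OF jk(4)] by metis
    then show ?thesis
      using meets[of k b] Suc.prems(1)[of "a + ?s j" "b + ?s k"] mem jk(1-3)
      by (auto simp: J_def)
  qed
  have cyc: "J 0 \<Longrightarrow> J 1" "J 1 \<Longrightarrow> J 2" "J 2 \<Longrightarrow> J 3" "J 3 \<Longrightarrow> J 4" "J 4 \<Longrightarrow> J 5" "J 5 \<Longrightarrow> J 6"
    "J 6 \<Longrightarrow> J 7" "J 7 \<Longrightarrow> J 0"
    by (erule step; simp add: X_def adj_def)+
  obtain k0 where "k0 \<in> X" "J k0"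
    using Suc.prems(2,3) meets by auto
  then have "J k" if "k \<in> X" for k
    using that cyc by (elim in_X_cases) blast+
  then show ?case
    using Suc.prems(4) by (auto simp: J_def)
qed

text \<open>Each cell shares some finite stage with the root cell, and that stage is
  connected.\<close>

lemma inf_cells_connected:
  assumes x: "\<And>i. x i \<in> X"
    and step: "\<And>c c'. c \<in> inf_cells x \<Longrightarrow> c' \<in> inf_cells x \<Longrightarrow> I c \<Longrightarrow> adj c c' \<Longrightarrow> I c'"
    and "I 0" "c \<in> inf_cells x"
  shows "I c"
proof -
  obtain n d where d: "d \<in> cells n" "c = d - offset x n"
    using assms(4) by (auto simp: inf_cells_def)
  have sub: "a - offset x n \<in> inf_cells x" if "a \<in> cells n" for a
    using that by (auto simp: inf_cells_def)
  have "0 \<in> (\<lambda>c. c - offset x n) ` cells n"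
    using shifted_cells_mono[of x 0 n] x by simp
  then have root: "offset x n \<in> cells n" by auto
  have "I (d - offset x n)"
  proof (rule cells_connected[where I = "\<lambda>c. I (c - offset x n)"])
    fix a b assume ab: "a \<in> cells n" "b \<in> cells n" "I (a - offset x n)" "adj a b"
    then have "adj (a - offset x n) (b - offset x n)"
      by (simp add: adj_def)
    then show "I (b - offset x n)"
      using ab by (blast intro: step sub)
  next
    show "I (offset x n - offset x n)"
      using \<open>I 0\<close> by (simp only: diff_self)
  qed (rule root d(1))+
  then show ?thesis using d(2) by simp
qed

text \<open>Having all four corners fixed passes from a cell to its edge-adjacent cells by
  \<open>neighbour_cell_fixed\<close>, hence from the root cell to all cells.\<close>

lemma fixes_root_square_imp_identity:
  assumes x: "\<And>i. x i \<in> X"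
    and inj: "inj_on h (verts (cell_graph (inf_cells x)))"
    and adj: "\<And>p q. {p, q} \<in> edges (cell_graph (inf_cells x)) \<Longrightarrow> adj (h p) (h q)"
    and root: "\<And>p. p \<in> corners 0 \<Longrightarrow> h p = p"
    and p: "p \<in> verts (cell_graph (inf_cells x))"
  shows "h p = p"
proof -
  obtain c where c: "c \<in> inf_cells x" "p \<in> corners c"
    using p by (auto simp: verts_cell_graph)
  have "\<forall>p\<in>corners c. h p = p"
  proof (rule inf_cells_connected[where I = "\<lambda>c. \<forall>p\<in>corners c. h p = p", OF x _ _ c(1)])
    fix c c' assume "c \<in> inf_cells x" "c' \<in> inf_cells x" "\<forall>p\<in>corners c. h p = p" "adj c c'"
    then show "\<forall>p\<in>corners c'. h p = p"
      using neighbour_cell_fixed[OF inj adj] by metis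
  qed (use root in blast)
  with c show ?thesis by blast
qed

section \<open>Isomorphisms as symmetries followed by translations\<close>

lemma corners_0: "corners 0 = {(0, 0), (1, 0), (1, 1), (0, 1)}"
  by (simp add: corners_def zero_prod_def)

text \<open>The images of the corners form a unit square. The directions of its two sides at
  \<open>f (0, 0)\<close> leave eight cases, one for each symmetry of the square.\<close>

lemma square_placement:
  assumes "adj (f (0, 0)) (f (1, 0))" "adj (f (0, 0)) (f (0, 1))" "adj (f (1, 0)) (f (1, 1))"
    "adj (f (0, 1)) (f (1, 1))" "f (0, 1) \<noteq> f (1, 0)" "f (1, 1) \<noteq> f (0, 0)"
  obtains i j \<tau> where "\<And>p. p \<in> corners 0 \<Longrightarrow> f p = (rot ^^ i \<circ> mirror ^^ j) p + \<tau>"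
proof -
  let ?u = "f (0, 0)"
  note cyc = four_cycle[OF assms] and place = that
  \<comment> \<open>Both \<open>f\<close> and \<open>g\<close> obey the parallelogram law on the
    corners, so equal side vectors at \<open>(0, 0)\<close> make them agree up to a translation on
    all four.\<close>
  have placement: thesis
    if "f (1, 0) - ?u = g (1, 0) - g (0, 0)" "f (0, 1) - ?u = g (0, 1) - g (0, 0)"
      "g (1, 1) + g (0, 0) = g (1, 0) + g (0, 1)" "g = rot ^^ i \<circ> mirror ^^ j" for g i j
  proof (rule place[of i j "?u - g (0, 0)"])
    fix p assume "p \<in> corners 0"
    then consider "p = (0, 0)" | "p = (1, 0)" | "p = (1, 1)" | "p = (0, 1)"
      by (auto simp: corners_0)
    then show "f p = (rot ^^ i \<circ> mirror ^^ j) p + (?u - g (0, 0))"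
      using that(1-3) cyc unfolding that(4)[symmetric]
      by cases (hypsubst, simp add: prod_eq_iff)+
  qed
  note simps = rot_def mirror_def numeral_2_eq_2 numeral_3_eq_3
  from assms(1) show thesis
  proof (cases rule: adj_cases)
    case 1
    from assms(2) show thesis
      by (cases rule: adj_cases)
        (use 1 cyc in \<open>auto simp: simps intro: placement[of _ 0 0, OF _ _ _ refl] placement[of _ 1 1, OF _ _ _ refl]\<close>)
  next
    case 2
    from assms(2) show thesis
      by (cases rule: adj_cases)
        (use 2 cyc in \<open>auto simp: simps intro: placement[of _ 2 0, OF _ _ _ refl] placement[of _ 3 1, OF _ _ _ refl]\<close>)
  next
    case 3
    from assms(2) show thesis
      by (cases rule: adj_cases)
        (use 3 cyc in \<open>auto simp: simps intro: placement[of _ 1 0, OF _ _ _ refl] placement[of _ 2 1, OF _ _ _ refl]\<close>)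
  next
    case 4
    from assms(2) show thesis
      by (cases rule: adj_cases)
        (use 4 cyc in \<open>auto simp: simps intro: placement[of _ 3 0, OF _ _ _ refl] placement[of _ 0 1, OF _ _ _ refl]\<close>)
  qed
qed

lemma funpow_image: "f ` S = S \<Longrightarrow> (f ^^ n) ` S = S"
  by (induction n) (simp_all only: funpow.simps image_id id_apply image_comp[symmetric])

lemma bij_rot: "bij rot"
  by (rule o_bij[of "\<lambda>p. (snd p, 1 - fst p)"]) (simp_all add: fun_eq_iff rot_def)

lemma bij_mirror: "bij mirror"
  by (rule o_bij[of mirror]) (simp_all add: fun_eq_iff mirror_def)

text \<open>The conclusion speaks of vertex sets only, because the holes will be read off from the
  vertices.\<close>

lemma isomorphic_imp_translate:
  assumes x: "\<And>i. x i \<in> X"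
    and iso: "graph_isomorphic (cell_graph (inf_cells x)) (cell_graph (inf_cells x'))"
  obtains \<sigma> \<tau> where "\<sigma> \<in> symmetries"
    "verts (cell_graph (inf_cells x')) = (\<lambda>p. p + \<tau>) ` verts (cell_graph (inf_cells (\<sigma> \<circ> x)))"
proof -
  let ?G = "cell_graph (inf_cells x)" and ?G' = "cell_graph (inf_cells x')"
  obtain f where f: "bij_betw f (verts ?G) (verts ?G')"
    and e: "\<forall>u\<in>verts ?G. \<forall>v\<in>verts ?G. {u, v} \<in> edges ?G \<longleftrightarrow> {f u, f v} \<in> edges ?G'"
    using iso unfolding graph_isomorphic_def by blast
  have edge_verts: "p \<in> verts ?G" if "{p, q} \<in> edges ?G" for p q
  proof -
    obtain c where "c \<in> inf_cells x" "{p, q} \<in> edges (translate c unit_square)"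
      using \<open>{p, q} \<in> edges ?G\<close> by (auto simp: cell_graph_def graph_Union_def)
    then show ?thesis
      by (auto simp: verts_cell_graph corners_eq translate_eq_graph_image edges_unit_square
          verts_unit_square doubleton_eq_iff intro!: bexI[of _ c])
  qed
  have fadj: "adj (f p) (f q)" if "{p, q} \<in> edges ?G" for p q
  proof -
    have "p \<in> verts ?G" "q \<in> verts ?G"
      using that edge_verts[of p q] edge_verts[of q p] by (simp_all add: insert_commute)
    then show ?thesis
      using that e edge_in_cell_graph_adj[of "f p" "f q"] by blast
  qed
  have "0 \<in> inf_cells x"
    unfolding inf_cells_def by (rule UN_I[of 0]) simp_all
  note E = square_edges_in_cell_graph[OF this, THEN fadj, unfolded add_0_left, unfolded zero_prod_def]
  have "corners 0 \<subseteq> verts ?G"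
    using \<open>0 \<in> inf_cells x\<close> by (auto simp: verts_cell_graph)
  then have "f (0, 1) \<noteq> f (1, 0)" "f (1, 1) \<noteq> f (0, 0)"
    using inj_on_eq_iff[OF bij_betw_imp_inj_on[OF f]] by (simp_all add: corners_0)
  from square_placement[OF E(1) E(4) E(2) E(3) this]
  obtain i j \<tau> where place: "\<And>p. p \<in> corners 0 \<Longrightarrow> f p = (rot ^^ i \<circ> mirror ^^ j) p + \<tau>"
    by blast
  define g where "g = rot ^^ i \<circ> mirror ^^ j"
  have g: "bij g"
    unfolding g_def by (intro bij_comp bij_fn bij_rot bij_mirror)
  have "rot ` corners 0 = corners 0" "mirror ` corners 0 = corners 0"
    by (auto simp: corners_0 rot_def mirror_def)
  then have "(rot ^^ i) ` corners 0 = corners 0" "(mirror ^^ j) ` corners 0 = corners 0"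
    by (simp_all add: funpow_image)
  then have g_corners: "g ` corners 0 = corners 0"
    by (simp only: g_def image_comp[symmetric])
  obtain \<sigma> where \<sigma>: "\<sigma> \<in> symmetries" "graph_image g ?G = cell_graph (inf_cells (\<sigma> \<circ> x))"
    using rot_mirror_cell_graph[of x i j, OF x] unfolding g_def by blast
  let ?H = "cell_graph (inf_cells (\<sigma> \<circ> x))"
  have vH: "verts ?H = g ` verts ?G" and eH: "edges ?H = (`) g ` edges ?G"
    by (simp_all flip: \<sigma>(2))
  define g' where "g' = inv_into UNIV g"
  have inv_g: "g' (g p) = p" "g (g' p) = p" for p
    using g by (simp_all add: g'_def bij_is_inj bij_is_surj surj_f_inv_f)
  \<comment> \<open>On the root square \<open>f\<close> is \<open>g\<close> followed by the
    translation by \<open>\<tau>\<close>, and \<open>g\<close> permutes its corners. Undoing both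
    gives a map that fixes the root square pointwise, so rigidity applies.\<close>
  define h where "h p = f (g' p) - \<tau>" for p
  have "h p = p" if "p \<in> verts ?H" for p
  proof (rule fixes_root_square_imp_identity[OF _ _ _ _ that])
    show "(\<sigma> \<circ> x) i \<in> X" for i
      using symmetry_isomorphic[OF \<sigma>(1)] x by (simp add: permutes_in_image)
    show "inj_on h (verts ?H)"
      using f by (auto simp: vH h_def inv_g inj_on_def bij_betw_def)
    show "adj (h p) (h q)" if pq: "{p, q} \<in> edges ?H" for p q
    proof -
      obtain d where d: "d \<in> edges ?G" "{p, q} = g ` d"
        using pq by (auto simp: eH)
      then have "g' ` {p, q} = d"
        by (simp add: image_comp comp_def inv_g)
      then have "adj (f (g' p)) (f (g' q))"
        using d(1) by (intro fadj) simp
      then show ?thesis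
        using adj_translate[of _ "- \<tau>"] by (simp add: h_def)
    qed
    show "h p = p" if pc: "p \<in> corners 0" for p
    proof -
      obtain q where "q \<in> corners 0" "p = g q"
        using pc g_corners by blast
      then show ?thesis
        using place[of q] by (simp add: h_def inv_g g_def[symmetric])
    qed
  qed
  then have fq: "f q = g q + \<tau>" if "q \<in> verts ?G" for q
    using that \<open>\<And>p. p \<in> verts ?H \<Longrightarrow> h p = p\<close>[of "g q"]
    by (simp add: vH h_def inv_g diff_eq_eq)
  then have "verts ?G' = (\<lambda>p. p + \<tau>) ` verts ?H"
    using bij_betw_imp_surj_on[OF f] fq by (auto simp: vH image_comp)
  with \<sigma>(1) show thesis by (rule that)
qed

section \<open>Holes of a carpet\<close>

text \<open>The open middle third of a period \<open>3 ^ Suc m\<close>. It is open because the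
  boundary of a hole belongs to the carpet; for \<open>m = 0\<close> it contains no integer, as a
  unit hole removes no vertex.\<close>

definition mid :: "nat \<Rightarrow> int \<Rightarrow> bool" where
  "mid m z \<longleftrightarrow> 3 ^ m < z mod 3 ^ Suc m \<and> z mod 3 ^ Suc m < 2 * 3 ^ m"

lemma mod_eq_imp_mid_eq:
  assumes "z mod 3 ^ Suc m = z' mod 3 ^ Suc m"
  shows "mid m z = mid m z'"
  using assms by (simp add: mid_def)

lemma mid_eq_add_multiple: "n > m \<Longrightarrow> mid m (z + 3 ^ n * t) = mid m z"
proof (rule mod_eq_imp_mid_eq)
  assume "n > m"
  then have "(3 :: int) ^ Suc m dvd 3 ^ n * t"
    by (intro dvd_mult2 le_imp_power_dvd) simp
  then show "(z + 3 ^ n * t) mod 3 ^ Suc m = z mod 3 ^ Suc m"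
    by (metis add.right_neutral dvd_imp_mod_0 mod_add_right_eq)
qed

lemma not_mid_if_dvd: "3 ^ m dvd z \<Longrightarrow> \<not> mid m z"
proof
  assume "3 ^ m dvd z" "mid m z"
  then have "3 ^ m dvd z mod 3 ^ Suc m"
    by (simp add: dvd_mod)
  then obtain k where k: "z mod 3 ^ Suc m = 3 ^ m * k" by (elim dvdE)
  have "3 ^ m * 1 < 3 ^ m * k" "3 ^ m * k < 3 ^ m * 2"
    using \<open>mid m z\<close> k by (simp_all add: mid_def)
  then have "1 < k" "k < 2" by simp_all
  then show False by simp
qed

lemma not_mid_if_small: "0 \<le> z \<Longrightarrow> z \<le> 3 ^ m \<Longrightarrow> \<not> mid m z"
proof -
  assume z: "0 \<le> z" "z \<le> 3 ^ m"
  have "(3 :: int) ^ m < 3 ^ Suc m" by simp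
  with z(2) have "z < 3 ^ Suc m" by (rule le_less_trans)
  with z(1) have "z mod 3 ^ Suc m = z" by (rule mod_pos_pos_trivial)
  then show ?thesis using z by (simp add: mid_def)
qed

lemma mid_top: "0 \<le> z \<Longrightarrow> z \<le> 3 ^ Suc m \<Longrightarrow> mid m z \<longleftrightarrow> 3 ^ m < z \<and> z < 2 * 3 ^ m"
proof -
  assume z: "0 \<le> z" "z \<le> 3 ^ Suc m"
  show ?thesis
  proof (cases "z = 3 ^ Suc m")
    case True
    then show ?thesis by (simp add: mid_def)
  next
    case False
    then have "z mod 3 ^ Suc m = z"
      using z by (intro mod_pos_pos_trivial) auto
    then show ?thesis by (simp add: mid_def)
  qed
qed

text \<open>The ternary description of the carpet. In the induction step the levels below
  \<open>n\<close> do not notice a shift by a multiple of \<open>3 ^ n\<close>, level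
  \<open>n\<close> is the new central hole, and for higher levels the coordinates are too small to
  be in a middle third.\<close>

lemma verts_carpet:
  "verts (carpet n) =
    {p. fst p \<in> {0..3 ^ n} \<and> snd p \<in> {0..3 ^ n} \<and> (\<forall>m. \<not> (mid m (fst p) \<and> mid m (snd p)))}"
proof (induction n)
  case 0
  have small: "\<not> mid m z" if "0 \<le> z" "z \<le> 1" for m z
    using that by (intro not_mid_if_small order.trans[OF that(2)]) auto
  have "verts (carpet 0) = {0, 1} \<times> {0, 1}"
    by (auto simp: verts_unit_square)
  also have "{0, 1} = {0..1 :: int}"
    by auto
  finally show ?case
    by (auto simp: small)
next
  case (Suc n)
  let ?V = "\<lambda>n. {p. fst p \<in> {0..3 ^ n} \<and> snd p \<in> {0..3 ^ n} \<and>
    (\<forall>m. \<not> (mid m (fst p) \<and> mid m (snd p)))} :: point set"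
  define s :: int where "s = 3 ^ n"
  have s: "s \<ge> 1" by (simp add: s_def)
  have mem: "p \<in> verts (carpet (Suc n)) \<longleftrightarrow> (\<exists>k\<in>X. p - scale s (cell k) \<in> ?V n)" for p
  proof -
    have "p \<in> verts (carpet (Suc n)) \<longleftrightarrow> (\<exists>k\<in>X. p \<in> (\<lambda>q. q + scale s (cell k)) ` verts (carpet n))"
      by (simp add: graph_Union_def translate_eq_graph_image s_def)
    also have "\<dots> \<longleftrightarrow> (\<exists>k\<in>X. p - scale s (cell k) \<in> verts (carpet n))"
      by (metis (no_types, lifting) add_diff_cancel diff_add_cancel imageE imageI)
    finally show ?thesis unfolding Suc .
  qed
  have low: "mid m (z - s * t) = mid m z" if "m < n" for m z t
    using mid_eq_add_multiple[OF that, of z "- t"] by (simp add: s_def)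
  have high: "\<not> mid m z" if "m \<ge> n" "0 \<le> z" "z \<le> s" for m z
  proof (rule not_mid_if_small)
    have "s \<le> 3 ^ m" unfolding s_def using that(1) by (rule power_increasing) simp
    with that(3) show "z \<le> 3 ^ m" by (rule order.trans)
  qed (rule that(2))
  have top: "mid n z \<longleftrightarrow> s < z \<and> z < 2 * s" if "0 \<le> z" "z \<le> 3 * s" for z
    using mid_top[of z n] that by (simp add: s_def)
  have "p \<in> verts (carpet (Suc n)) \<longleftrightarrow> p \<in> ?V (Suc n)" for p
  proof
    assume "p \<in> verts (carpet (Suc n))"
    then obtain k where k: "k \<in> X" and q: "p - scale s (cell k) \<in> ?V n"
      using mem by blast
    have range: "0 \<le> fst p - s * fst (cell k)" "fst p - s * fst (cell k) \<le> s"
      "0 \<le> snd p - s * snd (cell k)" "snd p - s * snd (cell k) \<le> s"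
      using q by (auto simp: s_def)
    have "0 \<le> s * fst (cell k)" "s * fst (cell k) \<le> 2 * s" "0 \<le> s * snd (cell k)"
      "s * snd (cell k) \<le> 2 * s"
      using cell_bounds[OF k] s by simp_all
    with range have big: "0 \<le> fst p" "fst p \<le> 3 * s" "0 \<le> snd p" "snd p \<le> 3 * s"
      by linarith+
    have "\<not> (mid m (fst p) \<and> mid m (snd p))" for m
    proof (cases "m < n")
      case True
      have "\<not> (mid m (fst p - s * fst (cell k)) \<and> mid m (snd p - s * snd (cell k)))"
        using q by simp
      then show ?thesis using low[OF True] by simp
    next
      case False
      show ?thesis
      proof (cases "m = n")
        case True
        have "t = 1" if "s < z" "z < 2 * s" "0 \<le> z - s * t" "z - s * t \<le> s" "t \<in> {0..2}" for z t :: int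
        proof -
          have "t = 0 \<or> t = 1 \<or> t = 2" using that(5) by auto
          then show ?thesis using that(1-4) by auto
        qed
        then show ?thesis
          using True top range big cell_bounds[OF k] cell_not_middle[OF k]
          by (metis prod.collapse)
      next
        case False
        then have "3 ^ Suc n \<le> (3 :: int) ^ m"
          using \<open>\<not> m < n\<close> by (intro power_increasing) auto
        then show ?thesis
          using big not_mid_if_small[of "fst p" m] by (simp add: s_def)
      qed
    qed
    then show "p \<in> ?V (Suc n)"
      using big by (simp add: s_def)
  next
    assume p: "p \<in> ?V (Suc n)"
    then have big: "0 \<le> fst p" "fst p \<le> 3 * s" "0 \<le> snd p" "snd p \<le> 3 * s"
      by (auto simp: s_def)
    \<comment> \<open>A coordinate on the border of two thirds is assigned to the outer one. Thus
      the digit 1 occurs only strictly inside, and the digits \<open>(1, 1)\<close> would mean a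
      point in the hole.\<close>
    have digit: "\<exists>t\<in>{0, 1, 2}. 0 \<le> z - s * t \<and> z - s * t \<le> s \<and> (t = 1 \<longrightarrow> mid n z)"
      if "0 \<le> z" "z \<le> 3 * s" for z
    proof -
      consider "z \<le> s" | "s < z" "z < 2 * s" | "2 * s \<le> z" by linarith
      then show ?thesis using that top[OF that] by cases auto
    qed
    obtain t1 t2 where t: "t1 \<in> {0, 1, 2}" "0 \<le> fst p - s * t1" "fst p - s * t1 \<le> s" "t1 = 1 \<longrightarrow> mid n (fst p)"
      "t2 \<in> {0, 1, 2}" "0 \<le> snd p - s * t2" "snd p - s * t2 \<le> s" "t2 = 1 \<longrightarrow> mid n (snd p)"
      using digit[OF big(1,2)] digit[OF big(3,4)] by blast
    have "(t1, t2) \<noteq> (1, 1)" using t p by auto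
    then obtain k where k: "k \<in> X" "cell k = (t1, t2)"
      using cell_surj t(1,5) by metis
    have "\<not> (mid m (fst p - s * t1) \<and> mid m (snd p - s * t2))" for m
    proof (cases "m < n")
      case True
      then show ?thesis using p low[OF True] by auto
    next
      case False
      then show ?thesis using high[of m "fst p - s * t1"] t(2,3) by simp
    qed
    then have "p - scale s (cell k) \<in> ?V n"
      using t k(2) by (simp add: s_def)
    then show "p \<in> verts (carpet (Suc n))"
      using mem k(1) by blast
  qed
  then show ?case by blast
qed

lemma carpet_shift_mono:
  assumes x: "\<And>i. x i \<in> X" and "m \<le> n" and "p + offset x m \<in> verts (carpet m)"
  shows "p + offset x n \<in> verts (carpet n)"
  using assms(2)
proof (induction n rule: dec_induct)
  case base
  show ?case by (rule assms(3))
next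
  case (step n)
  have "(p + offset x n) + scale (3 ^ n) (cell (x n)) \<in> verts (carpet (Suc n))"
    using step.IH x[of n] by (auto simp: graph_Union_def translate_eq_graph_image)
  then show ?case by (simp add: offset_Suc add.assoc)
qed

lemma verts_inf_iff:
  "p \<in> verts (cell_graph (inf_cells x)) \<longleftrightarrow> (\<exists>n. p + offset x n \<in> verts (carpet n))"
proof -
  have "verts (cell_graph ((\<lambda>c. c - offset x n) ` cells n)) = (\<lambda>p. p - offset x n) ` verts (carpet n)" for n
    using arg_cong[OF translate_cell_graph[of "- offset x n" "cells n"], of verts]
    by (simp add: translate_eq_graph_image carpet_eq_cell_graph)
  then have "verts (cell_graph (inf_cells x)) = (\<Union>n. (\<lambda>p. p - offset x n) ` verts (carpet n))"
    unfolding inf_cells_def cell_graph_UN by (simp add: graph_Union_def)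
  also have "p \<in> \<dots> \<longleftrightarrow> (\<exists>n. p + offset x n \<in> verts (carpet n))"
    by (simp add: image_iff eq_diff_eq)
  finally show ?thesis .
qed

section \<open>Existence and position of holes\<close>

lemma offset_split:
  assumes "m \<le> n"
  obtains r where "offset x n = offset x m + scale (3 ^ m) r"
proof -
  have "\<exists>r. offset x n = offset x m + scale (3 ^ m) r"
    using assms
  proof (induction n rule: dec_induct)
    case base
    have "offset x m = offset x m + scale (3 ^ m) 0" by (simp add: scale_def flip: zero_prod_def)
    then show ?case by blast
  next
    case (step n)
    then obtain r where r: "offset x n = offset x m + scale (3 ^ m) r" by blast
    have "scale (3 ^ n) (cell (x n)) = scale (3 ^ m) (scale (3 ^ (n - m)) (cell (x n)))"
      using step by (simp add: scale_def power_add[symmetric] mult.assoc[symmetric])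
    then have "offset x (Suc n) = offset x m + scale (3 ^ m) (r + scale (3 ^ (n - m)) (cell (x n)))"
      using r by (simp add: offset_Suc scale_add add.assoc)
    then show ?case by blast
  qed
  then show thesis using that by blast
qed

text \<open>Instead of a full square frame with missing interior, three boundary points and the missing
  row next to the bottom side already suffice to locate a hole.\<close>

definition hole_at :: "int \<Rightarrow> point \<Rightarrow> point set \<Rightarrow> bool" where
  "hole_at s h V \<longleftrightarrow> h + (0, 1) \<in> V \<and> h + (s, 1) \<in> V \<and> h + (1, 0) \<in> V \<and>
    (\<forall>i. 0 < i \<and> i < s \<longrightarrow> h + (i, 1) \<notin> V)"

lemma hole_at_translate: "hole_at s (h + \<tau>) ((\<lambda>p. p + \<tau>) ` V) \<longleftrightarrow> hole_at s h V"
proof -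
  have "h + \<tau> + q \<in> (\<lambda>p. p + \<tau>) ` V \<longleftrightarrow> h + q \<in> V" for q
  proof -
    have "h + \<tau> + q = (h + q) + \<tau>" by (simp only: ac_simps)
    then show ?thesis by auto
  qed
  then show ?thesis by (simp add: hole_at_def)
qed

text \<open>The central hole of \<open>carpet (Suc m)\<close> starts at
  \<open>(3 ^ m, 3 ^ m)\<close>. Later stages move it only by multiples of \<open>3 ^ Suc m\<close>,
  so it is never filled.\<close>

lemma hole_exists:
  assumes x: "\<And>i. x i \<in> X"
  shows "hole_at (3 ^ m) ((3 ^ m, 3 ^ m) - offset x (Suc m)) (verts (cell_graph (inf_cells x)))"
proof -
  define s :: int where "s = 3 ^ m"
  have s: "s \<ge> 1" by (simp add: s_def)
  \<comment> \<open>The sides of the hole have coordinates \<open>s\<close> and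
    \<open>2 * s\<close>: multiples of \<open>3 ^ j\<close> for \<open>j \<le> m\<close>, and at
    most \<open>3 ^ j\<close> for larger \<open>j\<close>. So they meet no hole of any
    level.\<close>
  have edge: "\<not> mid j (a * s)" if "a \<in> {1, 2}" for a j
  proof (cases "j \<le> m")
    case True
    then show ?thesis
      unfolding s_def by (intro not_mid_if_dvd dvd_mult le_imp_power_dvd)
  next
    case False
    then have "3 ^ Suc m \<le> (3 :: int) ^ j"
      by (intro power_increasing) auto
    moreover have "0 \<le> a * s" "a * s \<le> 3 ^ Suc m"
      using that s by (auto simp: s_def)
    ultimately show ?thesis
      by (intro not_mid_if_small) linarith+
  qed
  have edge': "\<not> mid j s" "\<not> mid j (2 * s)" for j
    using edge[of 1] edge[of 2] by simp_all
  have present: "(s, s) - offset x (Suc m) + q \<in> verts (cell_graph (inf_cells x))"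
    if "(s, s) + q \<in> verts (carpet (Suc m))" for q
    unfolding verts_inf_iff using that by (intro exI[of _ "Suc m"]) (simp add: algebra_simps)
  have "(s, s) - offset x (Suc m) + (i, 1) \<notin> verts (cell_graph (inf_cells x))"
    if i: "0 < i" "i < s" for i
  proof
    assume "(s, s) - offset x (Suc m) + (i, 1) \<in> verts (cell_graph (inf_cells x))"
    then obtain N where "(s, s) - offset x (Suc m) + (i, 1) + offset x N \<in> verts (carpet N)"
      unfolding verts_inf_iff by blast
    then have mem: "(s, s) - offset x (Suc m) + (i, 1) + offset x (max N (Suc m)) \<in> verts (carpet (max N (Suc m)))"
      by (rule carpet_shift_mono[of x N, OF x max.cobounded1])
    obtain r where r: "offset x (max N (Suc m)) = offset x (Suc m) + scale (3 ^ Suc m) r"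
      using offset_split[of "Suc m" "max N (Suc m)" x] by auto
    have "mid m (s + i + 3 ^ Suc m * fst r)" "mid m (s + 1 + 3 ^ Suc m * snd r)"
      unfolding mid_eq_add_multiple[OF lessI] using i by (simp_all add: mid_top s_def)
    with mem show False
      by (simp add: verts_carpet r algebra_simps)
  qed
  moreover have "(s, s) + (0, 1) \<in> verts (carpet (Suc m))" "(s, s) + (s, 1) \<in> verts (carpet (Suc m))"
      "(s, s) + (1, 0) \<in> verts (carpet (Suc m))"
    using edge' s by (simp_all add: verts_carpet del: carpet.simps flip: s_def)
  ultimately show ?thesis
    unfolding hole_at_def s_def[symmetric] using present by blast
qed

text \<open>A step of length one can enter an open middle third only from its left end; wrapping
  around gives the residue 0, which is outside.\<close>

lemma mid_boundary:
  assumes "mid j (z + 1)" "\<not> mid j z"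
  shows "z mod 3 ^ Suc j = 3 ^ j"
proof -
  define M :: int where "M = 3 ^ Suc j"
  have "M > 0" by (simp add: M_def)
  have "(z + 1) mod M \<noteq> 0"
    using assms(1) zero_less_power[of "3::int" j] unfolding mid_def M_def by linarith
  moreover have succ: "(z + 1) mod M = (z mod M + 1) mod M"
    by (simp only: mod_add_left_eq)
  ultimately have "z mod M + 1 \<noteq> M"
    by auto
  then have "0 \<le> z mod M + 1" "z mod M + 1 < M"
    using pos_mod_bound[OF \<open>M > 0\<close>, of z] pos_mod_sign[OF \<open>M > 0\<close>, of z] by linarith+
  then have "(z + 1) mod M = z mod M + 1"
    unfolding succ by (rule mod_pos_pos_trivial)
  then show ?thesis
    using assms unfolding mid_def M_def[symmetric] by linarith
qed

text \<open>The ends of the middle thirds of level \<open>l\<close> are multiples of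
  \<open>3 ^ l\<close>, hence of \<open>3 ^ k\<close>. An open interval between consecutive
  multiples of \<open>3 ^ k\<close> is therefore entirely inside or entirely outside.\<close>

lemma mid_block:
  assumes "k \<le> l" "0 < \<rho>" "\<rho> < 3 ^ k" "0 < \<rho>'" "\<rho>' < 3 ^ k" and "mid l (3 ^ k * a + \<rho>)"
  shows "mid l (3 ^ k * a + \<rho>')"
proof -
  define K R :: int where "K = 3 ^ k" and "R = 3 ^ (l - k)"
  have l: "3 ^ l = K * R" "3 ^ Suc l = K * (3 * R)"
    using assms(1) by (simp_all add: K_def R_def power_add[symmetric])
  have K: "K > 0" "R > 0" by (simp_all add: K_def R_def)
  define b where "b = a mod (3 * R)"
  have "(K * a + r) mod (K * (3 * R)) = K * b + r" if "0 < r" "r < K" for r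
    using that K by (simp add: zmod_zmult2_eq b_def)
  then have mid: "mid l (K * a + r) \<longleftrightarrow> K * R < K * b + r \<and> K * b + r < 2 * (K * R)"
    if "0 < r" "r < K" for r
    using that by (simp only: mid_def l)
  have lt: "K * R < K * b + \<rho>" "K * b + \<rho> < 2 * (K * R)"
    using assms mid[of \<rho>] by (simp_all add: K_def)
  \<comment> \<open>Rounding to multiples of \<open>K\<close> removes \<open>\<rho>\<close> from the
    bounds; they then hold for any other \<open>\<rho>'\<close> of the same block.\<close>
  have "K * R < K * (b + 1)" "K * b < K * (2 * R)"
    unfolding distrib_left mult.left_commute[of K 2] using lt assms(2,3) K_def by linarith+
  then have "R \<le> b" "b + 1 \<le> 2 * R"
    using K by simp_all
  then have "K * R \<le> K * b" "K * (b + 1) \<le> K * (2 * R)"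
    using K by simp_all
  then have "K * R < K * b + \<rho>'" "K * b + \<rho>' < 2 * (K * R)"
    unfolding distrib_left mult.left_commute[of K 2] using assms(4,5) K_def by linarith+
  then show ?thesis
    using mid[of \<rho>'] assms(4,5) by (simp add: K_def)
qed

text \<open>The gap starting at a hole of size \<open>3 ^ m\<close> cannot begin with a smaller hole: the right side of
  that smaller hole would be missing too, hence lie in a larger hole, which would then also contain
  the left side.\<close>

lemma hole_position:
  assumes x: "\<And>i. x i \<in> X" and m: "m \<ge> 1"
    and hole: "hole_at (3 ^ m) h (verts (cell_graph (inf_cells x)))"
  shows "(fst h + fst (offset x (Suc m))) mod 3 ^ Suc m = 3 ^ m"
    and "(snd h + snd (offset x (Suc m))) mod 3 ^ Suc m = 3 ^ m"
proof -
  define s :: int where "s = 3 ^ m"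
  let ?V = "verts (cell_graph (inf_cells x))"
  have V: "h + (0, 1) \<in> ?V" "h + (s, 1) \<in> ?V" "h + (1, 0) \<in> ?V"
    and gap: "\<And>i. 0 < i \<Longrightarrow> i < s \<Longrightarrow> h + (i, 1) \<notin> ?V"
    using hole by (simp_all add: hole_at_def s_def)
  obtain N1 N2 N3 where N: "h + (0, 1) + offset x N1 \<in> verts (carpet N1)"
    "h + (s, 1) + offset x N2 \<in> verts (carpet N2)" "h + (1, 0) + offset x N3 \<in> verts (carpet N3)"
    using V unfolding verts_inf_iff by blast
  define n where "n = Max {Suc m, N1, N2, N3}"
  have n: "Suc m \<le> n" "N1 \<le> n" "N2 \<le> n" "N3 \<le> n" by (simp_all add: n_def)
  define a b where "a = fst h + fst (offset x n)" and "b = snd h + snd (offset x n)"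
  have shift: "h + (i, j) + offset x n = (a + i, b + j)" for i j
    by (simp add: a_def b_def prod_eq_iff)
  have present: "(a, b + 1) \<in> verts (carpet n)" "(a + s, b + 1) \<in> verts (carpet n)"
    "(a + 1, b) \<in> verts (carpet n)"
    using carpet_shift_mono[of x, OF x n(2) N(1)] carpet_shift_mono[of x, OF x n(3) N(2)]
      carpet_shift_mono[of x, OF x n(4) N(3)]
    by (simp_all add: shift)
  \<comment> \<open>Both ends of the row lie in the square of side \<open>3 ^ n\<close>, hence so do
    the points between them, and only a hole can explain their absence.\<close>
  have missing: "\<exists>j. mid j (a + i) \<and> mid j (b + 1)" if i: "0 < i" "i < s" for i
  proof -
    have "(a + i, b + 1) \<notin> verts (carpet n)"
      using gap[OF i] shift unfolding verts_inf_iff by metis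
    then show ?thesis
      using present i by (auto simp: verts_carpet)
  qed
  \<comment> \<open>As \<open>m \<ge> 1\<close>, the gap is not empty and contains position
    1.\<close>
  have "3 ^ 1 \<le> s"
    unfolding s_def using m by (rule power_increasing) simp
  then obtain j where j: "mid j (a + 1)" "mid j (b + 1)"
    using missing[of 1] by auto
  \<comment> \<open>The vertices to the left of and below the missing point are present, so
    \<open>(a, b)\<close> is the lower left corner of a hole of level \<open>j\<close>. It remains
    to show that \<open>j\<close> is \<open>m\<close>.\<close>
  have "\<not> mid j a" "\<not> mid j b"
    using present j by (auto simp: verts_carpet)
  with j have ab: "a mod 3 ^ Suc j = 3 ^ j" "b mod 3 ^ Suc j = 3 ^ j"
    by (simp_all only: mid_boundary simp_thms)
  define A where "A = a div 3 ^ Suc j"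
  have a: "a = 3 ^ Suc j * A + 3 ^ j"
    using mult_div_mod_eq[of "3 ^ Suc j" a] unfolding ab(1) A_def by (rule sym)
  \<comment> \<open>A hole longer than \<open>s\<close> would also swallow the right end
    \<open>(a + s, b + 1)\<close> of the gap.\<close>
  have "j \<le> m"
  proof (rule ccontr)
    assume "\<not> j \<le> m"
    then have "s < 3 ^ j"
      unfolding s_def by (intro power_strict_increasing) auto
    then have "mid j (3 ^ Suc j * A + (3 ^ j + s))"
      using \<open>3 ^ 1 \<le> s\<close> by (simp add: mid_def)
    then show False
      using present(2) j(2) by (auto simp: verts_carpet a add.assoc)
  qed
  moreover have "\<not> j < m"
  proof
    assume "j < m"
    then have "3 ^ j < s"
      unfolding s_def by (intro power_strict_increasing) auto
    \<comment> \<open>Position \<open>3 ^ j\<close> is the right side of the smaller hole. It lies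
      in a block of length \<open>3 ^ Suc j\<close> together with the left side, so
      \<open>mid_block\<close> transfers \<open>mid l\<close> to \<open>a\<close>.\<close>
    then obtain l where l: "mid l (a + 3 ^ j)" "mid l (b + 1)"
      using missing[of "3 ^ j"] by auto
    have "\<not> l \<le> j"
    proof
      assume "l \<le> j"
      then have "3 ^ l dvd (3 :: int) ^ j" by (rule le_imp_power_dvd)
      then have "3 ^ l dvd a + 3 ^ j" by (simp add: a)
      then show False using l(1) not_mid_if_dvd by blast
    qed
    moreover have "mid l (3 ^ Suc j * A + 2 * 3 ^ j)"
      using l(1) by (simp add: a add.commute)
    ultimately have "mid l a"
      unfolding a by (intro mid_block[of "Suc j" l "2 * 3 ^ j" "3 ^ j"]) auto
    then show False
      using present(1) l(2) by (auto simp: verts_carpet)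
  qed
  ultimately have "j = m" by simp
  obtain r where "offset x n = offset x (Suc m) + scale (3 ^ Suc m) r"
    using offset_split[OF n(1)] by blast
  then have "a = fst h + fst (offset x (Suc m)) + 3 ^ Suc m * fst r"
    "b = snd h + snd (offset x (Suc m)) + 3 ^ Suc m * snd r"
    by (simp_all add: a_def b_def)
  then show "(fst h + fst (offset x (Suc m))) mod 3 ^ Suc m = 3 ^ m"
    "(snd h + snd (offset x (Suc m))) mod 3 ^ Suc m = 3 ^ m"
    using ab unfolding \<open>j = m\<close> by (simp_all only: mod_mult_self2)
qed

section \<open>Recovering the word\<close>

text \<open>With nonnegative sums the two bounds give absolute value below \<open>3 ^ n\<close>, so
  divisibility forces 0; consecutive zeros force equal digits. Divisibility starts at
  \<open>n = 2\<close> because \<open>hole_position\<close> requires \<open>m \<ge> 1\<close> and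
  \<open>n = Suc m\<close>.\<close>

lemma digits_eventually_eq:
  fixes d d' :: "nat \<Rightarrow> int" and \<tau> :: int
  defines "S \<equiv> \<lambda>n. \<Sum>i<n. 3 ^ i * d i" and "S' \<equiv> \<lambda>n. \<Sum>i<n. 3 ^ i * d' i"
  assumes nonneg: "\<And>i. d i \<ge> 0" "\<And>i. d' i \<ge> 0"
    and dvd: "\<And>n. n \<ge> 2 \<Longrightarrow> 3 ^ n dvd S' n - S n + \<tau>"
    and bound: "\<exists>N. \<forall>n\<ge>N. 1 - \<tau> + S n \<le> 3 ^ n" "\<exists>N. \<forall>n\<ge>N. 1 + \<tau> + S' n \<le> 3 ^ n"
  shows "finite {i. d i \<noteq> d' i}"
proof -
  obtain N N' where N: "\<And>n. n \<ge> N \<Longrightarrow> 1 - \<tau> + S n \<le> 3 ^ n"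
    "\<And>n. n \<ge> N' \<Longrightarrow> 1 + \<tau> + S' n \<le> 3 ^ n"
    using bound by blast
  define n0 where "n0 = Max {2, N, N'}"
  have zero: "S' n - S n + \<tau> = 0" if "n \<ge> n0" for n
  proof -
    have n: "n \<ge> 2" "n \<ge> N" "n \<ge> N'" using that by (simp_all add: n0_def)
    have "S n \<ge> 0" "S' n \<ge> 0"
      unfolding S_def S'_def by (intro sum_nonneg mult_nonneg_nonneg; simp add: nonneg)+
    then have "\<bar>S' n - S n + \<tau>\<bar> < 3 ^ n"
      using N(1)[OF n(2)] N(2)[OF n(3)] by linarith
    then show ?thesis
      using dvd_imp_le_int[OF _ dvd[OF n(1)]] by fastforce
  qed
  have "d i = d' i" if "i \<ge> n0" for i
  proof -
    have "S' (Suc i) - S (Suc i) + \<tau> = (S' i - S i + \<tau>) + 3 ^ i * (d' i - d i)"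
      by (simp add: S_def S'_def algebra_simps)
    then show ?thesis
      using zero[of i] zero[of "Suc i"] that by simp
  qed
  then have "{i. d i \<noteq> d' i} \<subseteq> {..<n0}"
    by (auto simp: not_le[symmetric])
  then show ?thesis
    by (rule finite_subset) simp
qed

lemma fst_offset: "fst (offset x n) = (\<Sum>i<n. 3 ^ i * fst (cell (x i)))"
  and snd_offset: "snd (offset x n) = (\<Sum>i<n. 3 ^ i * snd (cell (x i)))"
  by (simp_all add: offset_def fst_sum snd_sum)

lemma translate_imp_cofinal:
  assumes x: "\<And>i. x i \<in> X" "\<And>i. x' i \<in> X"
    and V: "verts (cell_graph (inf_cells x')) = (\<lambda>p. p + \<tau>) ` verts (cell_graph (inf_cells x))"
  shows "cofinal_words x' x"
proof -
  let ?V = "verts (cell_graph (inf_cells x))" and ?V' = "verts (cell_graph (inf_cells x'))"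
  have mem: "p + \<tau> \<in> ?V' \<longleftrightarrow> p \<in> ?V" for p
    unfolding V by auto
  have dvd: "3 ^ n dvd fst (offset x' n) - fst (offset x n) + fst \<tau> \<and>
      3 ^ n dvd snd (offset x' n) - snd (offset x n) + snd \<tau>" if "n \<ge> 2" for n
  proof -
    obtain m where m: "n = Suc m" "m \<ge> 1"
      using \<open>n \<ge> 2\<close> by (cases n) auto
    \<comment> \<open>The translated hole is a hole of the second carpet, so its position plus the
      offset of \<open>x'\<close> has residue \<open>3 ^ m\<close>. This cancels the
      \<open>3 ^ m\<close> in \<open>?h\<close> and leaves the difference of the offsets plus
      \<open>\<tau>\<close>.\<close>
    let ?h = "(3 ^ m, 3 ^ m) - offset x (Suc m)"
    have "hole_at (3 ^ m) (?h + \<tau>) ?V'"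
      unfolding V hole_at_translate by (rule hole_exists[of x, OF x(1)])
    note pos = hole_position[of x', OF x(2) m(2) this]
    show ?thesis
      using dvd_minus_mod[of "3 ^ Suc m" "fst (?h + \<tau>) + fst (offset x' (Suc m))"]
        dvd_minus_mod[of "3 ^ Suc m" "snd (?h + \<tau>) + snd (offset x' (Suc m))"]
      unfolding pos m(1) by (simp add: algebra_simps)
  qed
  \<comment> \<open>The far corner of the root cell, rather than the origin, supplies the summand 1
    that makes the final size estimate strict.\<close>
  have corner: "(1, 1) \<in> verts (cell_graph (inf_cells z))" for z
    unfolding verts_inf_iff by (rule exI[of _ 0]) (simp add: verts_unit_square)
  have "(1, 1) + \<tau> \<in> ?V'" "(1, 1) - \<tau> \<in> ?V"
    using mem[of "(1, 1)"] mem[of "(1, 1) - \<tau>"] corner by simp_all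
  then obtain N' N where
    N': "(1, 1) + \<tau> + offset x' N' \<in> verts (carpet N')" and N: "(1, 1) - \<tau> + offset x N \<in> verts (carpet N)"
    unfolding verts_inf_iff by blast
  have "fst ((1, 1) + \<tau> + offset x' n) \<le> 3 ^ n \<and> snd ((1, 1) + \<tau> + offset x' n) \<le> 3 ^ n" if "n \<ge> N'" for n
    using carpet_shift_mono[of x', OF x(2) that N'] by (simp add: verts_carpet)
  then have bound': "\<forall>n\<ge>N'. 1 + fst \<tau> + fst (offset x' n) \<le> 3 ^ n"
    "\<forall>n\<ge>N'. 1 + snd \<tau> + snd (offset x' n) \<le> 3 ^ n"
    by auto
  have "fst ((1, 1) - \<tau> + offset x n) \<le> 3 ^ n \<and> snd ((1, 1) - \<tau> + offset x n) \<le> 3 ^ n" if "n \<ge> N" for n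
    using carpet_shift_mono[of x, OF x(1) that N] by (simp add: verts_carpet)
  then have bound: "\<forall>n\<ge>N. 1 - fst \<tau> + fst (offset x n) \<le> 3 ^ n"
    "\<forall>n\<ge>N. 1 - snd \<tau> + snd (offset x n) \<le> 3 ^ n"
    by auto
  have nonneg: "fst (cell k) \<ge> 0 \<and> snd (cell k) \<ge> 0" if "k \<in> X" for k
    using cell_bounds[OF that] by simp
  have "finite {i. fst (cell (x i)) \<noteq> fst (cell (x' i))}"
    by (rule digits_eventually_eq[where \<tau> = "fst \<tau>"])
      (use nonneg x dvd bound(1) bound'(1) in \<open>auto simp flip: fst_offset\<close>)
  moreover have "finite {i. snd (cell (x i)) \<noteq> snd (cell (x' i))}"
    by (rule digits_eventually_eq[where \<tau> = "snd \<tau>"])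
      (use nonneg x dvd bound(2) bound'(2) in \<open>auto simp flip: snd_offset\<close>)
  moreover have "{i. x' i \<noteq> x i} \<subseteq>
      {i. fst (cell (x i)) \<noteq> fst (cell (x' i))} \<union> {i. snd (cell (x i)) \<noteq> snd (cell (x' i))}"
    using cell_inj x by (auto simp: prod_eq_iff)
  ultimately show ?thesis
    unfolding cofinal_words_def by (meson finite_UnI finite_subset)
qed

theorem mainTheorem2:
  fixes y y' :: corner and x x' :: "nat \<Rightarrow> nat"
  assumes "\<forall>i. x i \<in> X" and "\<forall>i. x' i \<in> X"
  shows "graph_isomorphic (inf_carpet y x) (inf_carpet y' x') \<longleftrightarrow>
           (\<exists>\<sigma>\<in>symmetries. cofinal_words x' (\<sigma> \<circ> x))"
proof -
  have range: "(\<sigma> \<circ> x) i \<in> X" if "\<sigma> \<in> symmetries" for \<sigma> i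
    using symmetry_isomorphic[OF that] assms(1) by (simp add: permutes_in_image)
  have x': "\<And>i. x' i \<in> X" using assms(2) by blast
  show ?thesis
    unfolding inf_carpet_isomorphic_iff
  proof
    assume "graph_isomorphic (cell_graph (inf_cells x)) (cell_graph (inf_cells x'))"
    then obtain \<sigma> \<tau> where "\<sigma> \<in> symmetries"
      "verts (cell_graph (inf_cells x')) = (\<lambda>p. p + \<tau>) ` verts (cell_graph (inf_cells (\<sigma> \<circ> x)))"
      using isomorphic_imp_translate[of x x'] assms(1) by blast
    then show "\<exists>\<sigma>\<in>symmetries. cofinal_words x' (\<sigma> \<circ> x)"
      using translate_imp_cofinal[of "\<sigma> \<circ> x" x' \<tau>, OF range x'] by blast
  next
    assume "\<exists>\<sigma>\<in>symmetries. cofinal_words x' (\<sigma> \<circ> x)"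
    then obtain \<sigma> where \<sigma>: "\<sigma> \<in> symmetries" "cofinal_words x' (\<sigma> \<circ> x)" by blast
    have "graph_isomorphic (cell_graph (inf_cells x')) (cell_graph (inf_cells (\<sigma> \<circ> x)))"
      using cofinal_imp_isomorphic[of x' "\<sigma> \<circ> x", OF x' range[OF \<sigma>(1)] \<sigma>(2)] .
    moreover have "graph_isomorphic (cell_graph (inf_cells x)) (cell_graph (inf_cells (\<sigma> \<circ> x)))"
      using symmetry_isomorphic[OF \<sigma>(1)] assms(1) by blast
    ultimately show "graph_isomorphic (cell_graph (inf_cells x)) (cell_graph (inf_cells x'))"
      by (blast intro: graph_isomorphic_trans graph_isomorphic_sym)
  qed
qed

end
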